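(* Let $U,V$ be monomials in $x_1,x_2,\ldots$ with $\min\{|U|,|V|\}=|U|=t\ge 2$. (a) If $U=x_1^t$, then $$\mathfrak{S}_U\mathfrak{S}_V=\sum_{W,Z}c^{W}_{x_1,Z}\,c^{Z}_{x_1^{t-1},V}\,\mathfrak{S}_W .$$ (b) If $U>x_1^t$ and $k$ is such that $\deg_{x_k}U\ge 1$, then $$\mathfrak{S}_U\mathfrak{S}_V=\sum_{W,Z}c^{Z}_{x_k,W}\,c^{W}_{U/x_k,\,V}\,\mathfrak{S}_Z-\sum_{W<U}\ \sum_{Z}c^{W}_{x_k,\,U/x_k}\,c^{Z}_{W,V}\,\mathfrak{S}_Z .$$ Here all sums are over monomials in $x_1,x_2,\ldots$.
   Context: $S_n$ is generated by $s_1,\ldots,s_{n-1}$, $s_i=(i,i+1)$. $s_if$ is the result of interchanging $x_i,x_{i+1}$ in the polynomial $f$, $\partial_i(f)=\frac{f-s_if}{x_i-x_{i+1}}$; for $u\in S_n$ with reduced word $s_{a_1}\cdots s_{a_p}$, $\partial_u=\partial_{a_1}\cdots\partial_{a_p}$ (independent of the reduced word). $\mathfrak{S}_{w_0^n}=x_1^{n-1}x_2^{n-2}\cdots x_{n-1}$; the polynomials $\partial_u\mathfrak{S}_{w_0^n}$, $u\in S_n$, $n\ge 2$, are the Schubert polynomials ($\partial_u\mathfrak{S}_{w_0^n}$ being that of $w_0^nu^{-1}$, $w_0^n$ the longest element of $S_n$). Monomial order: for monomials $U=\prod_ix_i^{k_i}$, $V=\prod_ix_i^{l_i}$ (take $N$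 bounding all indices that occur), $U<V$ iff $(\sum_ik_i,k_N,\ldots,k_2,k_1)<(\sum_il_i,l_N,\ldots,l_2,l_1)$ lexicographically. $|U|$ is the total degree of $U$ and $\deg_{x_k}U$ the exponent of $x_k$ in $U$. The leading monomial of a polynomial is its largest monomial. Every Schubert polynomial is monic (leading coefficient $1$), and every monomial $W$ in $x_1,x_2,\ldots$ is the leading monomial of exactly one Schubert polynomial, denoted $\mathfrak{S}_W$. The $\mathfrak{S}_W$ form a $\mathbb{Z}$-basis of $\mathbb{Z}[x_1,x_2,\ldots]$, and $c^W_{U,V}\in\mathbb{Z}$ are the structure constants defined by $\mathfrak{S}_U\mathfrak{S}_V=\sum_Wc^W_{U,V}\mathfrak{S}_W$. *)

theory Defs
  imports "HOL-Library.Poly_Mapping" "HOL-Combinatorics.Permutations"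
begin

(* Indices are shifted by one: index i stands for the variable x_{i+1}, for the adjacent
   transposition s_{i+1} and for the divided difference operator of index i+1.  In this way every
   element of the two types below is a monomial, respectively a polynomial, in x_1, x_2, ...
   A monomial is its exponent vector, so multiplication and division of monomials are + and -. *)

type_synonym monom = "nat \<Rightarrow>\<^sub>0 nat"
type_synonym mpoly = "monom \<Rightarrow>\<^sub>0 int"

abbreviation expo :: "monom \<Rightarrow> nat \<Rightarrow> nat" where
  "expo U i \<equiv> Poly_Mapping.lookup U i"

definition mvar_pow :: "nat \<Rightarrow> nat \<Rightarrow> monom" where
  "mvar_pow i t = Poly_Mapping.single i t"

abbreviation mvar :: "nat \<Rightarrow> monom" where
  "mvar i \<equiv> mvar_pow i 1"

definition monom_poly :: "monom \<Rightarrow> mpoly" where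
  "monom_poly U = Poly_Mapping.single U 1"

definition mdeg :: "monom \<Rightarrow> nat" where
  "mdeg U = (\<Sum>i\<in>Poly_Mapping.keys U. expo U i)"

(* Lexicographic comparison of (|U|, k_N, ..., k_1), the entries of largest index coming first.
   This is not the library order on the type monom, which compares small indices first. *)
definition mless :: "monom \<Rightarrow> monom \<Rightarrow> bool" where
  "mless U V \<longleftrightarrow> mdeg U < mdeg V \<or>
     (mdeg U = mdeg V \<and> (\<exists>i. expo U i < expo V i \<and> (\<forall>j>i. expo U j = expo V j)))"

definition lead_monom :: "mpoly \<Rightarrow> monom" where
  "lead_monom f = (THE U. U \<in> Poly_Mapping.keys f \<and>
     (\<forall>V\<in>Poly_Mapping.keys f. V \<noteq> U \<longrightarrow> mless V U))"

definition adj :: "nat \<Rightarrow> nat \<Rightarrow> nat" where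
  "adj i = Transposition.transpose i (Suc i)"

(* The coefficient of U in (swap_vars i f) is that of the monomial obtained from U by
   interchanging the exponents at i and Suc i. *)
definition swap_vars :: "nat \<Rightarrow> mpoly \<Rightarrow> mpoly" where
  "swap_vars i f = Poly_Mapping.map_key (Poly_Mapping.map_key (adj i)) f"

(* The exact quotient (f - s_i f) / (x_i - x_{i+1}) in the integral domain mpoly. *)
definition divdiff :: "nat \<Rightarrow> mpoly \<Rightarrow> mpoly" where
  "divdiff i f = (THE g. (monom_poly (mvar i) - monom_poly (mvar (Suc i))) * g
                          = f - swap_vars i f)"

(* S_n is the group of permutations of {..<n}, generated by the adj i with Suc i < n. *)
definition is_word :: "nat \<Rightarrow> (nat \<Rightarrow> nat) \<Rightarrow> nat list \<Rightarrow> bool" where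
  "is_word n u a \<longleftrightarrow> (\<forall>i\<in>set a. Suc i < n) \<and> foldr (\<lambda>i v. adj i \<circ> v) a id = u"

definition is_reduced_word :: "nat \<Rightarrow> (nat \<Rightarrow> nat) \<Rightarrow> nat list \<Rightarrow> bool" where
  "is_reduced_word n u a \<longleftrightarrow> is_word n u a \<and> (\<forall>b. is_word n u b \<longrightarrow> length a \<le> length b)"

(* The result does not depend on the choice of the reduced word. *)
definition divdiff_perm :: "nat \<Rightarrow> (nat \<Rightarrow> nat) \<Rightarrow> mpoly \<Rightarrow> mpoly" where
  "divdiff_perm n u f = foldr divdiff (SOME a. is_reduced_word n u a) f"

definition schubert_top :: "nat \<Rightarrow> mpoly" where
  "schubert_top n = (\<Prod>i<n - 1. monom_poly (mvar_pow i (n - 1 - i)))"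

definition is_schubert :: "mpoly \<Rightarrow> bool" where
  "is_schubert f \<longleftrightarrow>
     (\<exists>n\<ge>2. \<exists>u. u permutes {..<n} \<and> f = divdiff_perm n u (schubert_top n))"

definition schubert :: "monom \<Rightarrow> mpoly" where
  "schubert W = (THE f. is_schubert f \<and> lead_monom f = W)"

(* (sconst U V W) is the coefficient of (schubert W) in the expansion of the product. *)
definition sconst :: "monom \<Rightarrow> monom \<Rightarrow> monom \<Rightarrow> int" where
  "sconst U V = Poly_Mapping.lookup
     (THE c :: monom \<Rightarrow>\<^sub>0 int.
        schubert U * schubert V = (\<Sum>W. of_int (Poly_Mapping.lookup c W) * schubert W))"

end

(* Multiplying leading monomials gives the triangularity c^{U+V}_{U,V} = 1 and c^W_{U,V} = 0 unless
   W <= U+V, so S_U is S_{x_k} S_{U/x_k} minus a combination of S_W with W < U; multiplying by S_V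
   gives (b).  For (a), x_1^t is the smallest monomial of its degree, hence S_{x_1^t} = x_1^t.

   What has to be shown is that the leading monomials of the Schubert polynomials are exactly all
   monomials, without repetition.  The Schubert polynomials are followed down from the staircase
   monomial together with the code W of the permutation: the divided difference at i is applied only
   where W_i > W_{i+1}, and then replaces (W_i, W_{i+1}) by (W_{i+1}, W_i - 1).  The braid relations
   give local confluence: if W_i <= W_{i+1}, then the polynomial is a divided difference at i of the
   one with code (W_{i+1} + 1, W_i).  Hence the polynomial depends only on W.  That W is its leading
   monomial follows by induction on the degree, using the divided difference at the last descent. *)

theory Submission
  imports Defs
begin

declare One_nat_def [simp del]

section \<open>Monomials and their order\<close>

lemma adj_simps [simp]:
  "adj i i = Suc i" "adj i (Suc i) = i" "j \<noteq> i \<Longrightarrow> j \<noteq> Suc i \<Longrightarrow> adj i j = j"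
  by (auto simp: adj_def Transposition.transpose_def)

lemma adj_apply: "adj i j = (if j = i then Suc i else if j = Suc i then i else j)"
  by auto

lemma adj_adj [simp]: "adj i (adj i j) = j"
  by (auto simp: adj_apply)

lemma adj_comp_adj [simp]: "adj i \<circ> adj i = id"
  by auto

lemma inj_adj: "inj (adj i)"
  by (metis adj_adj injI)

text \<open>The action of an adjacent transposition on exponent vectors; \<open>swap_vars\<close> is
  \<open>map_key\<close> of this map, which is how it acts on coefficients.\<close>

definition mswap :: "nat \<Rightarrow> monom \<Rightarrow> monom" where
  "mswap i U = Poly_Mapping.map_key (adj i) U"

lemma lookup_mswap [simp]: "expo (mswap i U) j = expo U (adj i j)"
  by (simp add: mswap_def map_key.rep_eq[OF inj_adj])

lemma mswap_mswap [simp]: "mswap i (mswap i U) = U"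
  by (rule poly_mapping_eqI) simp

lemma inj_mswap: "inj (mswap i)"
  by (metis injI mswap_mswap)

lemma mswap_add: "mswap i (U + V) = mswap i U + mswap i V"
  by (rule poly_mapping_eqI) (simp add: lookup_add)

lemma mswap_id: "expo U i = expo U (Suc i) \<Longrightarrow> mswap i U = U"
  by (rule poly_mapping_eqI) (auto simp: adj_apply)

lemma mswap_mvar_pow [simp]:
  "mswap i (mvar_pow i t) = mvar_pow (Suc i) t" "mswap i (mvar_pow (Suc i) t) = mvar_pow i t"
  by (rule poly_mapping_eqI; auto simp: mvar_pow_def lookup_single when_def adj_apply)+

lemma lookup_mvar_pow: "expo (mvar_pow i t) j = (if j = i then t else 0)"
  by (simp add: mvar_pow_def lookup_single when_def)

lemma mdeg_superset:
  assumes "finite A" "Poly_Mapping.keys U \<subseteq> A"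
  shows "mdeg U = (\<Sum>i\<in>A. expo U i)"
  unfolding mdeg_def by (rule sum.mono_neutral_left) (use assms in \<open>auto simp: in_keys_iff\<close>)

lemma mdeg_add [simp]: "mdeg (U + V) = mdeg U + mdeg V"
proof -
  let ?A = "Poly_Mapping.keys U \<union> Poly_Mapping.keys V"
  have "mdeg (U + V) = (\<Sum>i\<in>?A. expo (U + V) i)"
    by (rule mdeg_superset) (auto simp: keys_add)
  also have "\<dots> = mdeg U + mdeg V"
    by (simp add: lookup_add sum.distrib mdeg_superset[of ?A])
  finally show ?thesis .
qed

lemma mdeg_mvar_pow [simp]: "mdeg (mvar_pow i t) = t"
  by (subst mdeg_superset[of "{i}"]) (auto simp: mvar_pow_def)

lemma mdeg_mswap [simp]: "mdeg (mswap i U) = mdeg U"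
proof -
  \<comment> \<open>Adding the two exchanged exponents crosswise gives an identity without
    subtraction, to which additivity of the degree applies.\<close>
  have "mswap i U + (mvar_pow i (expo U i) + mvar_pow (Suc i) (expo U (Suc i)))
      = U + (mvar_pow i (expo U (Suc i)) + mvar_pow (Suc i) (expo U i))"
    by (rule poly_mapping_eqI) (auto simp: lookup_add lookup_mvar_pow adj_apply)
  from arg_cong[OF this, of mdeg] show ?thesis by simp
qed

lemma mless_irrefl: "\<not> mless U U"
  by (simp add: mless_def)

lemma mless_trans: "mless U V \<Longrightarrow> mless V W \<Longrightarrow> mless U W"
proof -
  assume a: "mless U V" "mless V W"
  show "mless U W"
  proof (cases "mdeg U < mdeg V \<or> mdeg V < mdeg W")
    case True
    with a show ?thesis by (auto simp: mless_def)
  next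
    case False
    with a obtain i j where
      i: "expo U i < expo V i" "\<And>l. l > i \<Longrightarrow> expo U l = expo V l" and
      j: "expo V j < expo W j" "\<And>l. l > j \<Longrightarrow> expo V l = expo W l" and
      d: "mdeg U = mdeg V" "mdeg V = mdeg W"
      by (auto simp: mless_def)
    \<comment> \<open>In equal degree the larger of the two deciding indices decides the comparison
      of the outer monomials.\<close>
    have "expo U (max i j) < expo W (max i j) \<and> (\<forall>l>max i j. expo U l = expo W l)"
      using i j by (cases i j rule: linorder_cases) (auto simp: max_def)
    with d show ?thesis by (auto simp: mless_def)
  qed
qed

lemma mless_linear: "U = V \<or> mless U V \<or> mless V U"
proof (cases "mdeg U = mdeg V \<and> U \<noteq> V")
  case True
  \<comment> \<open>In equal degree the largest index at which the exponents differ decides.\<close>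
  let ?D = "{i. expo U i \<noteq> expo V i}"
  have "?D \<subseteq> Poly_Mapping.keys U \<union> Poly_Mapping.keys V"
    by (auto simp: in_keys_iff)
  then have fin: "finite ?D" by (rule finite_subset) simp
  have "?D \<noteq> {}" using True poly_mapping_eqI[of U V] by blast
  with fin have m: "Max ?D \<in> ?D" by (rule Max_in)
  define m where "m = Max ?D"
  have "expo U l = expo V l" if "m < l" for l
  proof (rule ccontr)
    assume "expo U l \<noteq> expo V l"
    then have "l \<le> m" unfolding m_def by (intro Max_ge[OF fin]) simp
    with that show False by simp
  qed
  moreover have "expo U m < expo V m \<or> expo V m < expo U m"
    using m unfolding m_def[symmetric] by (simp add: linorder_neq_iff)
  ultimately show ?thesis using True unfolding mless_def by metis
next
  case False
  then show ?thesis by (cases "mdeg U" "mdeg V" rule: linorder_cases) (auto simp: mless_def)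
qed

lemma mless_asym: "mless U V \<Longrightarrow> \<not> mless V U"
  using mless_irrefl mless_trans by blast

lemma mless_add_right: "mless U V \<Longrightarrow> mless (U + X) (V + X)"
  by (auto simp: mless_def lookup_add)

lemma mless_add_left: "mless U V \<Longrightarrow> mless (X + U) (X + V)"
  by (auto simp: mless_def lookup_add)

text \<open>With equal degree a smaller monomial has no variable beyond the last one of
  \<open>W\<close>, and its exponents are bounded by the degree. The restriction to one degree
  matters: there are infinitely many variables, hence infinitely many monomials of each smaller
  positive degree.\<close>

lemma finite_mless_same_mdeg: "finite {U. mless U W \<and> mdeg U = mdeg W}"
proof -
  obtain N where N: "\<And>j. j \<ge> N \<Longrightarrow> expo W j = 0"
  proof
    fix j assume "j \<ge> Suc (Max (insert 0 (Poly_Mapping.keys W)))"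
    then have "j \<notin> Poly_Mapping.keys W"
      by (metis Max_ge Suc_n_not_le_n finite_insert finite_keys insertCI le_trans)
    then show "expo W j = 0" by (simp add: in_keys_iff)
  qed
  let ?F = "{f. \<forall>j. (j \<in> {..<N} \<longrightarrow> f j \<in> {..mdeg W}) \<and> (j \<notin> {..<N} \<longrightarrow> f j = 0)}"
  have "{U. mless U W \<and> mdeg U = mdeg W} \<subseteq> Poly_Mapping.lookup -` ?F"
  proof (intro subsetI vimageI2 CollectI allI conjI impI)
    fix U j assume "U \<in> {U. mless U W \<and> mdeg U = mdeg W}"
    then have U: "mless U W" "mdeg U = mdeg W" by auto
    have "expo U j \<le> mdeg U"
    proof (cases "j \<in> Poly_Mapping.keys U")
      case True
      then show ?thesis unfolding mdeg_def by (intro member_le_sum) auto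
    qed (simp add: in_keys_iff)
    with U(2) show "expo U j \<in> {..mdeg W}" by simp
    from U obtain i where i: "expo U i < expo W i" "\<And>l. l > i \<Longrightarrow> expo U l = expo W l"
      by (auto simp: mless_def)
    assume "j \<notin> {..<N}"
    \<comment> \<open>The deciding index carries a positive exponent of \<open>W\<close>, so beyond
      \<open>N\<close> both monomials have exponent 0.\<close>
    moreover have "i < N" using i(1) N[of i] by (cases "i < N") auto
    ultimately show "expo U j = 0" using i(2)[of j] N[of j] by simp
  qed
  moreover have "inj (Poly_Mapping.lookup :: monom \<Rightarrow> _)"
    by (simp add: inj_def poly_mapping.lookup_inject)
  then have "finite (Poly_Mapping.lookup -` ?F :: monom set)"
    by (rule finite_vimageI[OF finite_set_of_finite_funs, rotated 2]) simp_all
  ultimately show ?thesis by (rule finite_subset)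
qed

text \<open>The number of smaller monomials of the same degree drops. Staying in one degree suffices
  later, because Schubert polynomials are homogeneous.\<close>

lemma finite_mless_same_mdeg_induct [case_names less]:
  assumes "\<And>W. (\<And>U. mless U W \<Longrightarrow> mdeg U = mdeg W \<Longrightarrow> P U) \<Longrightarrow> P W"
  shows "P W"
proof (induction "card {U. mless U W \<and> mdeg U = mdeg W}" arbitrary: W rule: less_induct)
  case less
  show ?case
  proof (rule assms, rule less)
    fix U assume U: "mless U W" "mdeg U = mdeg W"
    have "{V. mless V U \<and> mdeg V = mdeg U} \<subset> {V. mless V W \<and> mdeg V = mdeg W}"
      using U mless_trans[of _ U W] mless_irrefl[of U] by auto
    then show "card {V. mless V U \<and> mdeg V = mdeg U} < card {V. mless V W \<and> mdeg V = mdeg W}"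
      by (rule psubset_card_mono[OF finite_mless_same_mdeg])
  qed
qed

section \<open>Divided differences\<close>

text \<open>Polynomials form the free abelian group on the monomials, and differences generate all
  integer combinations. Additive statements thus need checking on monomials only.\<close>

lemma mpoly_induct [case_names zero monom diff]:
  assumes "P 0" "\<And>U. P (monom_poly U)" "\<And>f g. P f \<Longrightarrow> P g \<Longrightarrow> P (f - g)"
  shows "P (f :: mpoly)"
  by (rule frag_induction[of f UNIV P]) (use assms in \<open>auto simp: monom_poly_def\<close>)

lemma monom_poly_mult: "monom_poly U * monom_poly V = monom_poly (U + V)"
  by (simp add: monom_poly_def mult_single)

lemma monom_poly_zero [simp]: "monom_poly 0 = 1"
  by (simp add: monom_poly_def)

text \<open>Subtraction of exponents is truncated, hence the separate case in which the variable
  does not divide \<open>V\<close>.\<close>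

lemma lookup_mvar_mult:
  "Poly_Mapping.lookup (monom_poly (mvar i) * f) V
     = (if expo V i = 0 then 0 else Poly_Mapping.lookup f (V - mvar i))"
proof (induction f rule: mpoly_induct)
  case zero
  show ?case by simp
next
  case (monom U)
  have 1: "mvar i + U \<noteq> V" if "expo V i = 0"
    using that by (auto simp: lookup_add lookup_mvar_pow)
  have "mvar i + U = V \<longleftrightarrow> U = V - mvar i" if "expo V i \<noteq> 0"
    using that by (auto simp: poly_mapping_eq_iff fun_eq_iff lookup_add lookup_mvar_pow lookup_minus
        split: if_splits)
  with 1 show ?case
    by (auto simp: monom_poly_mult) (auto simp: monom_poly_def lookup_single when_def)
next
  case (diff f g)
  then show ?case by (auto simp: ring_distribs lookup_minus)
qed

lemma lookup_swap_vars [simp]: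
  "Poly_Mapping.lookup (swap_vars i f) V = Poly_Mapping.lookup f (mswap i V)"
proof -
  have eq: "Poly_Mapping.map_key (adj i) = mswap i"
    by (simp add: mswap_def fun_eq_iff)
  show ?thesis
    unfolding swap_vars_def eq by (simp add: map_key.rep_eq[OF inj_mswap])
qed

lemma swap_vars_swap_vars [simp]: "swap_vars i (swap_vars i f) = f"
  by (rule poly_mapping_eqI) simp

lemma swap_vars_zero [simp]: "swap_vars i 0 = 0"
  by (rule poly_mapping_eqI) simp

lemma swap_vars_diff: "swap_vars i (f - g) = swap_vars i f - swap_vars i g"
  by (rule poly_mapping_eqI) (simp add: lookup_minus)

lemma swap_vars_monom_poly [simp]: "swap_vars i (monom_poly U) = monom_poly (mswap i U)"
proof (rule poly_mapping_eqI)
  fix V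
  have "U = mswap i V \<longleftrightarrow> mswap i U = V" by auto
  then show "Poly_Mapping.lookup (swap_vars i (monom_poly U)) V
      = Poly_Mapping.lookup (monom_poly (mswap i U)) V"
    by (auto simp: monom_poly_def lookup_single when_def)
qed

lemma swap_vars_mult: "swap_vars i (f * g) = swap_vars i f * swap_vars i g"
proof (induction f rule: mpoly_induct)
  case (monom U)
  show ?case
    by (induction g rule: mpoly_induct)
      (simp_all add: monom_poly_mult mswap_add ring_distribs swap_vars_diff)
qed (simp_all add: ring_distribs swap_vars_diff)

abbreviation pvar :: "nat \<Rightarrow> mpoly" where
  "pvar i \<equiv> monom_poly (mvar i)"

lemma mswap_mvar: "mswap i (mvar j) = mvar (adj i j)"
  by (rule poly_mapping_eqI) (auto simp: lookup_mvar_pow adj_apply)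

lemma mvar_pow_inject: "mvar_pow i 1 = mvar_pow j 1 \<longleftrightarrow> i = j"
  by (metis lookup_mvar_pow zero_neq_one)

lemma monom_poly_inject: "monom_poly U = monom_poly V \<longleftrightarrow> U = V"
  unfolding monom_poly_def by (rule frag_of_eq)

lemma pvar_diff_neq_0: "i \<noteq> j \<Longrightarrow> pvar i - pvar j \<noteq> 0"
  by (simp add: monom_poly_inject mvar_pow_inject)

text \<open>Cancellation in an integral domain. Identities between divided differences are proved
  below by clearing denominators and then cancelling them with this rule.\<close>

lemma divdiff_quotient_unique:
  assumes "(pvar i - pvar (Suc i)) * g = (pvar i - pvar (Suc i)) * h"
  shows "g = h"
  by (rule mult_left_cancel[THEN iffD1, OF pvar_diff_neq_0 assms]) simp

lemma monom_poly_power: "monom_poly (mvar i) ^ p = monom_poly (mvar_pow i p)"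
proof (induction p)
  case 0
  show ?case by (simp add: mvar_pow_def)
next
  case (Suc p)
  have "mvar i + mvar_pow i p = mvar_pow i (Suc p)"
    by (rule poly_mapping_eqI) (simp add: lookup_add lookup_mvar_pow)
  with Suc show ?case by (simp add: monom_poly_mult)
qed

text \<open>If the exponent at \<open>i\<close> is the larger one, the monomial is a symmetric
  monomial \<open>M\<close> times a power of \<open>pvar i\<close>, and the numerator is
  \<open>M\<close> times a difference of equal powers, which the geometric sum divides. The opposite
  case differs by a sign.\<close>

lemma divdiff_quotient_exists: "\<exists>g. (pvar i - pvar (Suc i)) * g = f - swap_vars i f"
proof (induction f rule: mpoly_induct)
  case zero
  show ?case by (rule exI[of _ 0]) simp
next
  case (monom U)
  have *: "\<exists>g. (pvar i - pvar (Suc i)) * g = monom_poly U - monom_poly (mswap i U)"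
    if le: "expo U (Suc i) \<le> expo U i" for U
  proof -
    define p where "p = expo U i - expo U (Suc i)"
    define M where "M = U - mvar_pow i p"
    have U: "U = M + mvar_pow i p"
      by (rule poly_mapping_eqI) (auto simp: M_def p_def lookup_add lookup_minus lookup_mvar_pow)
    have M: "mswap i M = M"
      by (rule mswap_id) (use le in \<open>auto simp: M_def p_def lookup_minus lookup_mvar_pow\<close>)
    have "mswap i U = M + mvar_pow (Suc i) p"
      unfolding U mswap_add M by simp
    then have "monom_poly U - monom_poly (mswap i U) = monom_poly M * (pvar i ^ p - pvar (Suc i) ^ p)"
      by (simp add: U right_diff_distrib monom_poly_power monom_poly_mult)
    also have "\<dots> = (pvar i - pvar (Suc i)) *
        (monom_poly M * (\<Sum>j<p. pvar (Suc i) ^ (p - Suc j) * pvar i ^ j))"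
      unfolding power_diff_sumr2 by (rule mult.left_commute)
    finally show ?thesis by (intro exI) (rule sym)
  qed
  show ?case
  proof (cases "expo U (Suc i) \<le> expo U i")
    case True
    with * show ?thesis by simp
  next
    case False
    with *[of "mswap i U"] obtain g
      where "(pvar i - pvar (Suc i)) * g = monom_poly (mswap i U) - monom_poly U" by auto
    then have "(pvar i - pvar (Suc i)) * (- g) = monom_poly U - monom_poly (mswap i U)"
      unfolding mult_minus_right by (simp only: minus_diff_eq)
    then show ?thesis unfolding swap_vars_monom_poly by (rule exI)
  qed
next
  case (diff f g)
  then obtain f' g' where "(pvar i - pvar (Suc i)) * f' = f - swap_vars i f"
    "(pvar i - pvar (Suc i)) * g' = g - swap_vars i g" by blast
  then have "(pvar i - pvar (Suc i)) * (f' - g') = f - g - swap_vars i (f - g)"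
    by (simp add: right_diff_distrib swap_vars_diff)
  then show ?case by (rule exI)
qed

lemma divdiff_mult: "(pvar i - pvar (Suc i)) * divdiff i f = f - swap_vars i f"
proof -
  obtain g where g: "(pvar i - pvar (Suc i)) * g = f - swap_vars i f"
    using divdiff_quotient_exists by blast
  show ?thesis
    unfolding divdiff_def
  proof (rule theI[of _ g])
    fix h assume "(pvar i - pvar (Suc i)) * h = f - swap_vars i f"
    with g show "h = g" by (intro divdiff_quotient_unique[of i h g]) (simp only:)
  qed (rule g)
qed

lemma divdiff_eqI: "(pvar i - pvar (Suc i)) * g = f - swap_vars i f \<Longrightarrow> divdiff i f = g"
  by (rule divdiff_quotient_unique[of i]) (simp add: divdiff_mult)

text \<open>Numerator and denominator both change sign under the exchange.\<close>

lemma swap_vars_divdiff [simp]: "swap_vars i (divdiff i f) = divdiff i f"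
proof (rule divdiff_quotient_unique[of i])
  have "swap_vars i ((pvar i - pvar (Suc i)) * divdiff i f) = swap_vars i f - f"
    by (simp add: divdiff_mult swap_vars_diff)
  then have "(pvar (Suc i) - pvar i) * swap_vars i (divdiff i f) = swap_vars i f - f"
    by (simp add: swap_vars_mult swap_vars_diff)
  then have "(pvar i - pvar (Suc i)) * swap_vars i (divdiff i f) = f - swap_vars i f"
    by (metis minus_diff_eq mult_minus_left)
  then show "(pvar i - pvar (Suc i)) * swap_vars i (divdiff i f)
      = (pvar i - pvar (Suc i)) * divdiff i f"
    by (simp only: divdiff_mult)
qed

lemma divdiff_eq_0_iff: "divdiff i f = 0 \<longleftrightarrow> swap_vars i f = f"
  using divdiff_mult[of i f] pvar_diff_neq_0[of i "Suc i"] by auto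

section \<open>Commutation and braid relations\<close>

lemma mswap_commute: "Suc i < j \<or> Suc j < i \<Longrightarrow> mswap i (mswap j U) = mswap j (mswap i U)"
  by (rule poly_mapping_eqI) (auto simp: adj_apply)

lemma mswap_braid:
  "mswap i (mswap (Suc i) (mswap i U)) = mswap (Suc i) (mswap i (mswap (Suc i) U))"
  by (rule poly_mapping_eqI) (auto simp: adj_apply)

lemma swap_vars_commute: "Suc i < j \<or> Suc j < i \<Longrightarrow> swap_vars i (swap_vars j f) = swap_vars j (swap_vars i f)"
  by (rule poly_mapping_eqI) (simp add: mswap_commute[of i j])

lemma swap_vars_braid:
  "swap_vars i (swap_vars (Suc i) (swap_vars i f)) = swap_vars (Suc i) (swap_vars i (swap_vars (Suc i) f))"
  by (rule poly_mapping_eqI) (simp add: mswap_braid)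

lemma swap_vars_pvar: "swap_vars i (pvar j) = pvar (adj i j)"
  by (simp only: swap_vars_monom_poly mswap_mvar)

text \<open>The exchange at a distant \<open>j\<close> fixes both variables of the denominator at
  \<open>i\<close>.\<close>

lemma divdiff_swap_vars_commute:
  assumes "Suc i < j \<or> Suc j < i"
  shows "divdiff i (swap_vars j f) = swap_vars j (divdiff i f)"
proof (rule divdiff_eqI)
  have "swap_vars j ((pvar i - pvar (Suc i)) * divdiff i f)
      = swap_vars j f - swap_vars j (swap_vars i f)"
    by (simp only: divdiff_mult swap_vars_diff)
  moreover have "swap_vars j (pvar i - pvar (Suc i)) = pvar i - pvar (Suc i)"
    using assms by (auto simp: swap_vars_diff swap_vars_pvar simp del: swap_vars_monom_poly)
  ultimately show "(pvar i - pvar (Suc i)) * swap_vars j (divdiff i f)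
      = swap_vars j f - swap_vars i (swap_vars j f)"
    by (simp add: swap_vars_mult swap_vars_commute[OF assms])
qed

text \<open>With both denominators cleared, each side is the alternating sum of \<open>f\<close>
  over the group generated by the two commuting exchanges.\<close>

lemma divdiff_commute:
  assumes "Suc i < j \<or> Suc j < i"
  shows "divdiff i (divdiff j f) = divdiff j (divdiff i f)"
proof (rule divdiff_eqI)
  have "(pvar j - pvar (Suc j)) * ((pvar i - pvar (Suc i)) * divdiff j (divdiff i f))
    = (pvar i - pvar (Suc i)) * ((pvar j - pvar (Suc j)) * divdiff j (divdiff i f))"
    by (simp add: mult_ac)
  also have "\<dots> = (pvar i - pvar (Suc i)) * divdiff i f
      - (pvar i - pvar (Suc i)) * divdiff i (swap_vars j f)"
    using assms by (simp add: divdiff_mult divdiff_swap_vars_commute right_diff_distrib)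
  also have "\<dots> = (f - swap_vars j f) - swap_vars i (f - swap_vars j f)"
    by (simp add: divdiff_mult swap_vars_diff)
  also have "\<dots> = (pvar j - pvar (Suc j)) * divdiff j f
      - (pvar j - pvar (Suc j)) * divdiff j (swap_vars i f)"
    by (simp add: divdiff_mult swap_vars_diff swap_vars_commute[OF assms])
  also have "\<dots> = (pvar j - pvar (Suc j)) * (divdiff j f - swap_vars i (divdiff j f))"
    using assms by (subst divdiff_swap_vars_commute) (auto simp: right_diff_distrib)
  finally show "(pvar i - pvar (Suc i)) * divdiff j (divdiff i f)
      = divdiff j f - swap_vars i (divdiff j f)"
    by (rule divdiff_quotient_unique)
qed

text \<open>Clearing denominators turns both sides of the braid relation into the antisymmetrization
  over the symmetric group on three variables.\<close>

lemma divdiff_braid: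
  "divdiff i (divdiff (Suc i) (divdiff i f)) = divdiff (Suc i) (divdiff i (divdiff (Suc i) f))"
proof -
  let ?x = "pvar i" and ?y = "pvar (Suc i)" and ?z = "pvar (Suc (Suc i))"
  let ?s = "swap_vars i" and ?t = "swap_vars (Suc i)"
  let ?A = "f - ?s f - ?t f + ?t (?s f) + ?s (?t f) - ?s (?t (?s f))"
  have sx: "?s ?x = ?y" "?s ?y = ?x" "?s ?z = ?z" "?t ?x = ?x" "?t ?y = ?z" "?t ?z = ?y"
    by (simp_all only: swap_vars_pvar adj_apply) simp_all
  note sw = swap_vars_diff swap_vars_mult sx
  have 1: "(?x - ?y) * (?x - ?z) * (?y - ?z) * divdiff i (divdiff (Suc i) (divdiff i f)) = ?A"
  proof -
    define g where "g = divdiff i f"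
    define h where "h = divdiff (Suc i) g"
    have g: "(?x - ?y) * g = f - ?s f" unfolding g_def by (rule divdiff_mult)
    have sg: "?s g = g" unfolding g_def by (rule swap_vars_divdiff)
    have h: "(?y - ?z) * h = g - ?t g" unfolding h_def by (rule divdiff_mult)
    \<comment> \<open>The exchange turns the factor \<open>?y - ?z\<close> of the preceding equation
      into \<open>?x - ?z\<close> and fixes \<open>g\<close>. The remaining equations arise in the
      same way.\<close>
    have sh: "(?x - ?z) * ?s h = g - ?s (?t g)"
      using arg_cong[OF h, of ?s] by (simp only: sw sg)
    have tg: "(?x - ?z) * ?t g = ?t f - ?t (?s f)"
      using arg_cong[OF g, of ?t] by (simp only: sw)
    have stg: "(?y - ?z) * ?s (?t g) = ?s (?t f) - ?s (?t (?s f))"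
      using arg_cong[OF tg, of ?s] by (simp only: sw)
    have "(?x - ?y) * (?x - ?z) * (?y - ?z) * divdiff i h
        = (?x - ?z) * (?y - ?z) * ((?x - ?y) * divdiff i h)"
      by (simp add: mult_ac)
    also have "\<dots> = (?x - ?z) * ((?y - ?z) * h) - (?y - ?z) * ((?x - ?z) * ?s h)"
      unfolding divdiff_mult by (simp add: algebra_simps)
    also have "\<dots> = (?x - ?y) * g - (?x - ?z) * ?t g + (?y - ?z) * ?s (?t g)"
      unfolding h sh by (simp add: algebra_simps)
    also have "\<dots> = ?A" unfolding g tg stg by simp
    finally show ?thesis by (simp add: g_def h_def)
  qed
  have 2: "(?x - ?y) * (?x - ?z) * (?y - ?z) * divdiff (Suc i) (divdiff i (divdiff (Suc i) f)) = ?A"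
  proof -
    define g where "g = divdiff (Suc i) f"
    define h where "h = divdiff i g"
    have g: "(?y - ?z) * g = f - ?t f" unfolding g_def by (rule divdiff_mult)
    have sg: "?t g = g" unfolding g_def by (rule swap_vars_divdiff)
    have h: "(?x - ?y) * h = g - ?s g" unfolding h_def by (rule divdiff_mult)
    have sh: "(?x - ?z) * ?t h = g - ?t (?s g)"
      using arg_cong[OF h, of ?t] by (simp only: sw sg)
    have tg: "(?x - ?z) * ?s g = ?s f - ?s (?t f)"
      using arg_cong[OF g, of ?s] by (simp only: sw)
    have stg: "(?x - ?y) * ?t (?s g) = ?t (?s f) - ?t (?s (?t f))"
      using arg_cong[OF tg, of ?t] by (simp only: sw)
    have "(?x - ?y) * (?x - ?z) * (?y - ?z) * divdiff (Suc i) h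
        = (?x - ?z) * (?x - ?y) * ((?y - ?z) * divdiff (Suc i) h)"
      by (simp add: mult_ac)
    also have "\<dots> = (?x - ?z) * ((?x - ?y) * h) - (?x - ?y) * ((?x - ?z) * ?t h)"
      unfolding divdiff_mult by (simp add: algebra_simps)
    also have "\<dots> = (?y - ?z) * g - (?x - ?z) * ?s g + (?x - ?y) * ?t (?s g)"
      unfolding h sh by (simp add: algebra_simps)
    also have "\<dots> = ?A" unfolding g tg stg swap_vars_braid by simp
    finally show ?thesis by (simp add: g_def h_def)
  qed
  have "(?x - ?y) * (?x - ?z) * (?y - ?z) \<noteq> 0"
    by (simp only: mult_eq_0_iff de_Morgan_disj) (auto intro!: pvar_diff_neq_0 simp del: right_minus_eq)
  with 1 2 mult_left_cancel show ?thesis by metis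
qed

section \<open>Homogeneity\<close>

definition homog :: "nat \<Rightarrow> mpoly \<Rightarrow> bool" where
  "homog d f \<longleftrightarrow> (\<forall>U\<in>Poly_Mapping.keys f. mdeg U = d)"

lemma homog_mult: "homog d f \<Longrightarrow> homog e g \<Longrightarrow> homog (d + e) (f * g)"
  using keys_mult[of f g] by (fastforce simp: homog_def)

text \<open>The factor of degree one can be cancelled since the part of \<open>g\<close> outside degree \<open>d\<close> is mapped
  to the part of the product outside degree \<open>d + 1\<close>.\<close>

lemma homog_divdiff:
  assumes f: "homog (Suc d) f"
  shows "homog d (divdiff i f)"
proof -
  define g where "g = divdiff i f"
  define g1 :: mpoly where "g1 = Poly_Mapping.Abs_poly_mapping (\<lambda>U. Poly_Mapping.lookup g U when mdeg U = d)"
  have lg1: "Poly_Mapping.lookup g1 U = (Poly_Mapping.lookup g U when mdeg U = d)" for U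
    unfolding g1_def
    by (subst lookup_Abs_poly_mapping)
      (auto intro: finite_subset[OF _ finite_lookup[of g]])
  define D where "D = pvar i - pvar (Suc i)"
  have mp: "mdeg V = Suc d \<longleftrightarrow> mdeg (V - mvar j) = d" if "expo V j \<noteq> 0" for V j
  proof -
    have "V = (V - mvar j) + mvar j"
      using that by (intro poly_mapping_eqI) (auto simp: lookup_add lookup_minus lookup_mvar_pow)
    then have "mdeg V = mdeg (V - mvar j) + 1"
      by (metis mdeg_add mdeg_mvar_pow)
    then show ?thesis by simp
  qed
  have "D * g1 = D * g"
  proof (rule poly_mapping_eqI)
    fix V
    have 0: "Poly_Mapping.lookup (D * g) V = 0" if "mdeg V \<noteq> Suc d"
    proof -
      have "V \<notin> Poly_Mapping.keys f" "mswap i V \<notin> Poly_Mapping.keys f"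
        using f that by (auto simp: homog_def)
      then show ?thesis
        by (simp add: D_def g_def divdiff_mult lookup_minus in_keys_iff)
    qed
    have "Poly_Mapping.lookup (D * g1) V = (Poly_Mapping.lookup (D * g) V when mdeg V = Suc d)"
      using mp[of V i] mp[of V "Suc i"]
      by (auto simp: D_def left_diff_distrib lookup_minus lookup_mvar_mult lg1 when_def)
    then show "Poly_Mapping.lookup (D * g1) V = Poly_Mapping.lookup (D * g) V"
      using 0 by (auto simp: when_def)
  qed
  then have "g1 = g" unfolding D_def by (rule divdiff_quotient_unique)
  have "homog d g"
    unfolding homog_def
  proof
    fix U assume "U \<in> Poly_Mapping.keys g"
    then show "mdeg U = d"
      using lg1[of U] \<open>g1 = g\<close> by (cases "mdeg U = d") (simp_all add: in_keys_iff)
  qed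
  then show ?thesis by (simp add: g_def)
qed

text \<open>The exchange fixes \<open>V\<close>, so the numerator is \<open>V\<close> times the
  denominator.\<close>

lemma divdiff_monom_poly:
  assumes "expo V i = expo V (Suc i)"
  shows "divdiff i (monom_poly (V + mvar i)) = monom_poly V"
  by (rule divdiff_eqI)
     (simp add: mswap_id[OF assms] mswap_add left_diff_distrib monom_poly_mult add.commute)

section \<open>Divided differences of the staircase monomial along descents\<close>

lemma lookup_sum_mvar_pow:
  "expo (\<Sum>i<n. mvar_pow i (c i)) j = (if j < n then c j else 0)"
  by (simp add: lookup_sum lookup_mvar_pow)

definition stair :: "nat \<Rightarrow> monom" where
  "stair n = (\<Sum>i<n - 1. mvar_pow i (n - 1 - i))"

lemma lookup_stair [simp]: "expo (stair n) i = n - 1 - i"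
  by (simp add: stair_def lookup_sum_mvar_pow)

lemma monom_poly_sum: "finite A \<Longrightarrow> (\<Prod>i\<in>A. monom_poly (c i)) = monom_poly (\<Sum>i\<in>A. c i)"
  by (induction A rule: finite_induct) (simp_all add: monom_poly_mult)

lemma schubert_top_eq: "schubert_top n = monom_poly (stair n)"
  by (simp add: schubert_top_def stair_def monom_poly_sum)

text \<open>On the entries at \<open>i\<close> and \<open>i + 1\<close> this is (a, b) to (b, a -
  1). The subtraction is truncated, so the move is reversible only for positive a, in particular at
  descents.\<close>

definition down :: "nat \<Rightarrow> monom \<Rightarrow> monom" where
  "down i W = mswap i W - mvar (Suc i)"

definition up :: "nat \<Rightarrow> monom \<Rightarrow> monom" where
  "up i W = mswap i W + mvar i"

lemma lookup_down: "expo (down i W) j =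
    (if j = i then expo W (Suc i) else if j = Suc i then expo W i - 1 else expo W j)"
  by (simp add: down_def lookup_minus lookup_mvar_pow adj_apply)

lemma lookup_up: "expo (up i W) j =
    (if j = i then expo W (Suc i) + 1 else if j = Suc i then expo W i else expo W j)"
  by (simp add: up_def lookup_add lookup_mvar_pow adj_apply)

lemma down_up [simp]: "down i (up i W) = W"
  by (rule poly_mapping_eqI) (simp add: lookup_up lookup_down)

lemma up_down: "0 < expo W i \<Longrightarrow> up i (down i W) = W"
  by (rule poly_mapping_eqI) (simp add: lookup_up lookup_down)

lemma mdeg_up [simp]: "mdeg (up i W) = Suc (mdeg W)"
  by (simp add: up_def)

lemma mdeg_down: "0 < expo W i \<Longrightarrow> mdeg W = Suc (mdeg (down i W))"
  by (metis mdeg_up up_down)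

text \<open>The vector \<open>W\<close> plays the part of the Lehmer code, so that the polynomials
  can be studied before permutations enter. The number \<open>k\<close> of steps is the measure for
  the confluence argument.\<close>

inductive sch :: "nat \<Rightarrow> nat \<Rightarrow> monom \<Rightarrow> mpoly \<Rightarrow> bool" for n where
  top: "sch n 0 (stair n) (schubert_top n)"
| step: "sch n k W f \<Longrightarrow> Suc i < n \<Longrightarrow> expo W (Suc i) < expo W i
    \<Longrightarrow> sch n (Suc k) (down i W) (divdiff i f)"

text \<open>Any derivation of a vector with an ascent at \<open>i\<close> can be rearranged to end
  with a step at \<open>i\<close>. If its last step is at a distant \<open>j\<close>, one appeal to
  the induction hypothesis and commutation suffice; if \<open>j\<close> is a neighbour, two appeals
  expose three steps to which the braid relation applies.\<close>

lemma sch_ascent: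
  "sch n k W f \<Longrightarrow> Suc i < n \<Longrightarrow> expo W i \<le> expo W (Suc i)
    \<Longrightarrow> \<exists>h l. k = Suc l \<and> sch n l (up i W) h \<and> f = divdiff i h"
proof (induction k arbitrary: W f i rule: less_induct)
  case (less k)
  from less.prems(1) show ?case
  proof cases
    case top
    \<comment> \<open>The staircase is strictly decreasing on the admissible positions, so it has no
      ascent.\<close>
    with less.prems show ?thesis by simp
  next
    case (step k0 W0 g j)
    note IH = less.IH and asc = less.prems(3)
    consider "i = j" | "Suc i < j \<or> Suc j < i" | "i = Suc j" | "j = Suc i" by linarith
    then show ?thesis
    proof cases
      case 1
      with step show ?thesis by (intro exI[of _ g] exI[of _ k0]) (simp add: up_down)
    next
      case 2
      have "expo W0 i \<le> expo W0 (Suc i)"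
        using 2 asc by (auto simp: step(2) lookup_down)
      from IH[OF _ step(4) less.prems(2) this] step(1) obtain h l
        where h: "k0 = Suc l" "sch n l (up i W0) h" "g = divdiff i h" by auto
      have "sch n (Suc l) (down j (up i W0)) (divdiff j h)"
        by (rule sch.step[OF h(2) step(5)]) (use 2 step(6) in \<open>auto simp: lookup_up\<close>)
      moreover have "down j (up i W0) = up i W"
        by (rule poly_mapping_eqI) (use 2 in \<open>auto simp: step(2) lookup_up lookup_down\<close>)
      ultimately show ?thesis
        using 2 step h by (intro exI[of _ "divdiff j h"] exI[of _ "Suc l"]) (simp add: divdiff_commute[OF 2])
    next
      case 3
      let ?j' = "Suc j"
      \<comment> \<open>The descent of \<open>W0\<close> at \<open>j\<close> and the ascent of
        \<open>W\<close> at \<open>j + 1\<close> give \<open>W0\<close> at \<open>j + 1\<close> at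
        most (\<open>W0\<close> at \<open>j\<close>) - 1, which is at most \<open>W0\<close> at
        \<open>j + 2\<close>.\<close>
      have "expo W0 ?j' \<le> expo W0 (Suc ?j')"
        using asc step(6) by (simp add: step(2) lookup_down 3)
      from IH[OF _ step(4) _ this] less.prems(2) step(1) obtain h l
        where h: "k0 = Suc l" "sch n l (up ?j' W0) h" "g = divdiff ?j' h" by (auto simp: 3)
      have "expo (up ?j' W0) j \<le> expo (up ?j' W0) (Suc j)"
        using asc by (simp add: step(2) lookup_up lookup_down 3)
      from IH[OF _ h(2) step(5) this] step(1) h(1) obtain p l'
        where p: "l = Suc l'" "sch n l' (up j (up ?j' W0)) p" "h = divdiff j p" by auto
      \<comment> \<open>From \<open>p\<close> the polynomial was reached by steps at
        \<open>j\<close>, \<open>j + 1\<close>, \<open>j\<close>. They are replaced by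
        \<open>j + 1\<close>, \<open>j\<close>, \<open>j + 1\<close>, whose first two are carried
        out here; the third is the required step at \<open>i\<close>.\<close>
      have s1: "sch n (Suc l') (down ?j' (up j (up ?j' W0))) (divdiff ?j' p)"
        by (rule sch.step[OF p(2)]) (use less.prems(2) step(6) in \<open>auto simp: 3 lookup_up\<close>)
      have "sch n (Suc (Suc l')) (down j (down ?j' (up j (up ?j' W0)))) (divdiff j (divdiff ?j' p))"
        by (rule sch.step[OF s1 step(5)])
          (use step(6) asc in \<open>auto simp: step(2) 3 lookup_up lookup_down\<close>)
      moreover have "down j (down ?j' (up j (up ?j' W0))) = up i W"
        by (rule poly_mapping_eqI) (auto simp: step(2) 3 lookup_up lookup_down)
      ultimately show ?thesis
        using step h p
        by (intro exI[of _ "divdiff j (divdiff ?j' p)"] exI[of _ "Suc (Suc l')"])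
          (simp add: 3 divdiff_braid)
    next
      case 4
      have "expo W0 i \<le> expo W0 j"
        using asc step(6) by (simp add: step(2) lookup_down 4)
      from IH[OF _ step(4) less.prems(2) this[unfolded 4]] step(1) obtain h l
        where h: "k0 = Suc l" "sch n l (up i W0) h" "g = divdiff i h" by auto
      have "expo (up i W0) j \<le> expo (up i W0) (Suc j)"
        using asc by (simp add: step(2) lookup_up lookup_down 4)
      from IH[OF _ h(2) step(5) this] step(1) h(1) obtain p l'
        where p: "l = Suc l'" "sch n l' (up j (up i W0)) p" "h = divdiff j p" by auto
      have s1: "sch n (Suc l') (down i (up j (up i W0))) (divdiff i p)"
        by (rule sch.step[OF p(2) less.prems(2)]) (use step(6) in \<open>auto simp: 4 lookup_up\<close>)
      have "sch n (Suc (Suc l')) (down j (down i (up j (up i W0)))) (divdiff j (divdiff i p))"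
        by (rule sch.step[OF s1 step(5)])
          (use step(6) asc in \<open>auto simp: step(2) 4 lookup_up lookup_down\<close>)
      moreover have "down j (down i (up j (up i W0))) = up i W"
        by (rule poly_mapping_eqI) (auto simp: step(2) 4 lookup_up lookup_down)
      ultimately show ?thesis
        using step h p
        by (intro exI[of _ "divdiff j (divdiff i p)"] exI[of _ "Suc (Suc l')"])
          (simp add: 4 divdiff_braid)
    qed
  qed
qed

text \<open>The last step of the first derivation leaves an ascent at its position, so the second
  derivation can be made to end there too; the induction hypothesis compares what precedes.\<close>

lemma sch_unique_level: "sch n k W f \<Longrightarrow> sch n l W g \<Longrightarrow> f = g"
proof (induction arbitrary: l g rule: sch.induct)
  case top
  then show ?case
  proof cases
    case (step k0 W0 g0 j)
    \<comment> \<open>A step at \<open>j\<close> would leave an ascent at \<open>j\<close>, which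
      the staircase does not have.\<close>
    have "expo (down j W0) (Suc j) < expo (down j W0) j"
      unfolding step(2)[symmetric] using step(5) by simp
    then show ?thesis using step(6) by (simp add: lookup_down)
  qed simp
next
  case (step k W f i)
  have "expo (down i W) i \<le> expo (down i W) (Suc i)"
    using step by (simp add: lookup_down)
  from sch_ascent[OF step.prems step.hyps(2) this] obtain h l'
    where h: "sch n l' (up i (down i W)) h" "g = divdiff i h" by auto
  then show ?case using step.IH[of l' h] step.hyps by (simp add: up_down)
qed

text \<open>Stability: steps at 0, ..., n - 1 in turn lower each of the first \<open>n\<close>
  entries of the larger staircase by one. All intermediate polynomials are monomials
  \<open>M j\<close>, the first \<open>j\<close> entries being lowered already.\<close>

lemma sch_stair_Suc: "\<exists>l. sch (Suc n) l (stair n) (schubert_top n)"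
proof -
  define M where "M j = (\<Sum>i<n. mvar_pow i (n - i - (if i < j then 1 else 0)))" for j
  have M: "expo (M j) i = n - i - (if i < j then 1 else 0)" for i j
    by (simp add: M_def lookup_sum_mvar_pow)
  have "sch (Suc n) j (M j) (monom_poly (M j))" if "j \<le> n" for j
    using that
  proof (induction j)
    case 0
    have "M 0 = stair (Suc n)"
      by (rule poly_mapping_eqI) (simp add: M)
    then show ?case using sch.top[of "Suc n"] by (simp add: schubert_top_eq)
  next
    case (Suc j)
    have "M (Suc j) = down j (M j)"
      by (rule poly_mapping_eqI) (use Suc.prems in \<open>auto simp: M lookup_down\<close>)
    moreover have "M j = M (Suc j) + mvar j"
      by (rule poly_mapping_eqI) (use Suc.prems in \<open>auto simp: M lookup_add lookup_mvar_pow\<close>)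
    then have "divdiff j (monom_poly (M j)) = monom_poly (M (Suc j))"
      using divdiff_monom_poly[of "M (Suc j)" j] by (auto simp: M)
    moreover have "sch (Suc n) (Suc j) (down j (M j)) (divdiff j (monom_poly (M j)))"
      by (rule sch.step) (use Suc in \<open>auto simp: M\<close>)
    ultimately show ?case by simp
  qed
  from this[of n] have "sch (Suc n) n (M n) (monom_poly (M n))" by simp
  moreover have "M n = stair n"
    by (rule poly_mapping_eqI) (auto simp: M)
  ultimately show ?thesis by (auto simp: schubert_top_eq)
qed

lemma sch_Suc: "sch n k W f \<Longrightarrow> \<exists>l. sch (Suc n) l W f"
proof (induction rule: sch.induct)
  case top
  show ?case by (rule sch_stair_Suc)
next
  case (step k W f i)
  then show ?case using sch.step[of "Suc n" _ W f i] less_SucI by blast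
qed

lemma sch_mono:
  assumes "n \<le> m" "sch n k W f"
  shows "\<exists>l. sch m l W f"
  using assms by (induction rule: dec_induct) (use sch_Suc in blast)+

text \<open>Stability lifts both derivations to a common \<open>n\<close>.\<close>

lemma sch_unique: "sch n k W f \<Longrightarrow> sch m l W g \<Longrightarrow> f = g"
  using sch_mono[of n "max n m" k W f] sch_mono[of m "max n m" l W g] sch_unique_level
  by fastforce

text \<open>For \<open>n = 0\<close> the staircase is itself the zero vector and its monomial is
  1.\<close>

lemma sch_0:
  assumes "sch n k 0 f"
  shows "f = 1"
proof -
  have "stair 0 = 0" by (rule poly_mapping_eqI) simp
  then have "sch 0 0 0 1" using sch.top[of 0] by (simp add: schubert_top_eq)
  from sch_unique[OF assms this] show ?thesis .
qed

lemma sch_homog: "sch n k W f \<Longrightarrow> homog (mdeg W) f"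
proof (induction rule: sch.induct)
  case top
  show ?case by (simp add: schubert_top_eq homog_def monom_poly_def)
next
  case (step k W f i)
  have "mdeg W = Suc (mdeg (down i W))"
    by (rule mdeg_down) (use step in simp)
  then show ?case using step.IH homog_divdiff by simp
qed

section \<open>Leading monomials\<close>

definition monic_lead :: "mpoly \<Rightarrow> monom \<Rightarrow> bool" where
  "monic_lead f W \<longleftrightarrow> Poly_Mapping.lookup f W = 1 \<and> (\<forall>U\<in>Poly_Mapping.keys f. U \<noteq> W \<longrightarrow> mless U W)"

lemma lead_monom_eqI: "monic_lead f W \<Longrightarrow> lead_monom f = W"
proof -
  assume "monic_lead f W"
  then have W: "W \<in> Poly_Mapping.keys f" "\<And>U. U \<in> Poly_Mapping.keys f \<Longrightarrow> U \<noteq> W \<Longrightarrow> mless U W"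
    by (auto simp: monic_lead_def in_keys_iff)
  show ?thesis
    unfolding lead_monom_def
  proof (rule the_equality)
    fix U assume "U \<in> Poly_Mapping.keys f \<and> (\<forall>V\<in>Poly_Mapping.keys f. V \<noteq> U \<longrightarrow> mless V U)"
    with W show "U = W" by (metis mless_asym)
  qed (use W in simp)
qed

text \<open>By symmetry a variable that occurs beyond \<open>i\<close> would push all later
  variables into \<open>f\<close> one after the other, but only finitely many occur.\<close>

lemma vanish_above_if_symmetric:
  assumes sym: "\<And>j. i < j \<Longrightarrow> swap_vars j f = f" and U: "U \<in> Poly_Mapping.keys f" and "i < j"
  shows "expo U j = 0"
proof (rule ccontr)
  assume "expo U j \<noteq> 0"
  have ex: "\<exists>V\<in>Poly_Mapping.keys f. expo V m \<noteq> 0" if "j \<le> m" for m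
    using that
  proof (induction m rule: dec_induct)
    case base
    show ?case using U \<open>expo U j \<noteq> 0\<close> by blast
  next
    case (step m)
    then obtain V where V: "V \<in> Poly_Mapping.keys f" "expo V m \<noteq> 0" by blast
    have "swap_vars m f = f" using sym step \<open>i < j\<close> by simp
    then have "mswap m V \<in> Poly_Mapping.keys f"
      using V(1) by (metis in_keys_iff lookup_swap_vars mswap_mswap)
    moreover have "expo (mswap m V) (Suc m) \<noteq> 0" using V by simp
    ultimately show ?case by blast
  qed
  define K where "K = (\<Union>V\<in>Poly_Mapping.keys f. Poly_Mapping.keys V)"
  have "finite K" by (simp add: K_def)
  moreover have "{j..} \<subseteq> K" using ex by (auto simp: K_def in_keys_iff)
  ultimately show False using finite_subset infinite_Ici by blast
qed

text \<open>Compare coefficients at \<open>V + mvar (Suc i)\<close> in the defining equation of the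
  quotient: on the left only the term of \<open>pvar (Suc i)\<close> contributes, on the right only
  the exchanged polynomial.\<close>

lemma lookup_divdiff_vanish:
  assumes f: "\<And>U. U \<in> Poly_Mapping.keys f \<Longrightarrow> expo U (Suc i) = 0" and V: "expo V i = 0"
  shows "Poly_Mapping.lookup (divdiff i f) V = Poly_Mapping.lookup f (up i V)"
proof -
  define V' where "V' = V + mvar (Suc i)"
  have V': "expo V' i = 0" "expo V' (Suc i) \<noteq> 0" "V' - mvar (Suc i) = V" "mswap i V' = up i V"
    using V by (simp_all add: V'_def lookup_add lookup_mvar_pow up_def mswap_add mswap_mvar)
  have "Poly_Mapping.lookup ((pvar i - pvar (Suc i)) * divdiff i f) V'
      = - Poly_Mapping.lookup (divdiff i f) V"
    using V' by (simp add: left_diff_distrib lookup_minus lookup_mvar_mult)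
  moreover have "Poly_Mapping.lookup f V' = 0"
    using f[of V'] V' by (auto simp: in_keys_iff)
  ultimately show ?thesis by (simp add: divdiff_mult lookup_minus V')
qed

text \<open>With \<open>i\<close> the last descent, the polynomial involves no variable beyond \<open>i\<close>, and its divided
  difference at \<open>i\<close> determines the part divisible by that variable without cancellation.\<close>

lemma sch_monic_lead: "sch n k W f \<Longrightarrow> monic_lead f W"
proof (induction "mdeg W" arbitrary: n k W f rule: less_induct)
  case less
  show ?case
  proof (cases "W = 0")
    case True
    with sch_0 less.prems have "f = 1" by blast
    with True show ?thesis by (simp add: monic_lead_def lookup_one)
  next
    case False
    define i where "i = Max (Poly_Mapping.keys W)"
    have ne: "Poly_Mapping.keys W \<noteq> {}"
      using False poly_mapping_eqI[of W 0] by (auto simp: in_keys_iff)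
    have Wi: "0 < expo W i"
      using Max_in[OF finite_keys ne] by (simp add: i_def in_keys_iff)
    have Wj: "expo W j = 0" if "i < j" for j
      using Max_ge[OF finite_keys, of j W] that unfolding i_def by (meson in_keys_iff not_le)
    \<comment> \<open>Beyond \<open>i\<close> the vector \<open>W\<close> is zero, which counts as
      an ascent at \<open>j\<close>. After enlarging \<open>n\<close> to admit \<open>j\<close>, the
      polynomial is a divided difference at \<open>j\<close>.\<close>
    have sym: "swap_vars j f = f" if ij: "i < j" for j
    proof -
      obtain l where l: "sch (max n (Suc (Suc j))) l W f"
        using sch_mono[OF max.cobounded1 less.prems] by blast
      obtain h where "f = divdiff j h"
        using sch_ascent[OF l, of j] Wj[of j] Wj[of "Suc j"] ij by (auto simp: less_max_iff_disj)
      then show ?thesis by simp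
    qed
    note vanish = vanish_above_if_symmetric[of i f, OF sym]
    define g where "g = divdiff i f"
    have g: "Poly_Mapping.lookup g V = Poly_Mapping.lookup f (up i V)" if "expo V i = 0" for V
      unfolding g_def by (rule lookup_divdiff_vanish) (use vanish that in auto)
    obtain l where "sch (max n (Suc (Suc i))) l W f"
      using sch_mono[OF max.cobounded1 less.prems] by blast
    from sch.step[OF this, of i] have "sch (max n (Suc (Suc i))) (Suc l) (down i W) g"
      using Wi Wj[of "Suc i"] by (simp add: g_def less_max_iff_disj)
    with mdeg_down[OF Wi] less.hyps have lg: "monic_lead g (down i W)" by auto
    show ?thesis
      unfolding monic_lead_def
    proof (intro conjI ballI impI)
      show "Poly_Mapping.lookup f W = 1"
        using lg g[of "down i W"] Wi Wj[of "Suc i"] by (simp add: monic_lead_def lookup_down up_down)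
      fix U assume U: "U \<in> Poly_Mapping.keys f" "U \<noteq> W"
      have Uj: "expo U j = 0" if "i < j" for j using vanish U that by blast
      have d: "mdeg U = mdeg W" using sch_homog[OF less.prems] U by (auto simp: homog_def)
      show "mless U W"
      proof (cases "expo U i = 0")
        case True
        then show ?thesis using d Wi Uj Wj by (auto simp: mless_def intro!: exI[of _ i])
      next
        case False
        then have Ui: "0 < expo U i" by simp
        have "Poly_Mapping.lookup g (down i U) = Poly_Mapping.lookup f U"
          using g[of "down i U"] Ui Uj[of "Suc i"] by (simp add: lookup_down up_down)
        then have "down i U \<in> Poly_Mapping.keys g" using U by (simp add: in_keys_iff)
        moreover have "down i U \<noteq> down i W" using U up_down Ui Wi by metis
        ultimately have "mless (down i U) (down i W)" using lg by (simp add: monic_lead_def)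
        then obtain p where p: "expo (down i U) p < expo (down i W) p"
          "\<And>l. p < l \<Longrightarrow> expo (down i U) l = expo (down i W) l"
          using mdeg_down[OF Ui] mdeg_down[OF Wi] d by (auto simp: mless_def)
        \<comment> \<open>After the move both vectors have entry 0 at \<open>i\<close>, while the
          former entries at \<open>i\<close>, lowered by one, stand at \<open>i + 1\<close>. So the
          comparison is decided at \<open>i + 1\<close> or below \<open>i\<close>.\<close>
        have "p \<le> Suc i" using p(1) Wj[of p] by (cases "p \<le> Suc i") (auto simp: lookup_down)
        moreover have "p \<noteq> i" using p(1) Wj[of "Suc i"] by (auto simp: lookup_down)
        ultimately consider "p = Suc i" | "p < i" by linarith
        then show ?thesis
        proof cases
          case 1
          then have "expo U i < expo W i" using p(1) by (simp add: lookup_down)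
          then show ?thesis using d Uj Wj by (auto simp: mless_def intro!: exI[of _ i])
        next
          case 2
          have "expo U l = expo W l" if "p < l" for l
          proof -
            consider "l < i" | "l = i" | "i < l" by linarith
            then show ?thesis
            proof cases
              case 1
              with p(2)[OF that] show ?thesis by (simp add: lookup_down)
            next
              case 2
              then show ?thesis using p(2)[of "Suc i"] \<open>p < i\<close> Ui Wi by (simp add: lookup_down)
            qed (simp add: Uj Wj)
          qed
          moreover have "expo U p < expo W p" using p(1) 2 by (simp add: lookup_down)
          ultimately show ?thesis using d by (auto simp: mless_def intro!: exI[of _ p])
        qed
      qed
    qed
  qed
qed

section \<open>Every exponent vector is reached\<close>

lemma mdeg_le_stair:
  assumes "\<And>j. expo W j \<le> n - 1 - j"
  shows "mdeg W \<le> mdeg (stair n)"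
proof -
  have "stair n = (stair n - W) + W"
  proof (rule poly_mapping_eqI)
    fix j show "expo (stair n) j = expo (stair n - W + W) j"
      using assms[of j] by (simp add: lookup_add lookup_minus)
  qed
  then show ?thesis by (metis le_add2 mdeg_add)
qed

text \<open>Climb by \<open>up\<close> at ascents: the degree grows but stays bounded by that of the
  staircase, and only the staircase has no ascent left.\<close>

lemma sch_exists:
  assumes "\<And>j. expo W j \<le> n - 1 - j"
  shows "\<exists>k f. sch n k W f"
  using assms
proof (induction "mdeg (stair n) - mdeg W" arbitrary: W rule: less_induct)
  case less
  show ?case
  proof (cases "\<exists>i. Suc i < n \<and> expo W i \<le> expo W (Suc i)")
    case True
    then obtain i where i: "Suc i < n" "expo W i \<le> expo W (Suc i)" by blast
    \<comment> \<open>The new entry at \<open>i\<close> is allowed one more than the old one at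
      \<open>i + 1\<close>, and the new entry at \<open>i + 1\<close> is at most the old one
      there.\<close>
    have le: "expo (up i W) j \<le> n - 1 - j" for j
      using less.prems[of j] less.prems[of "Suc i"] i by (auto simp: lookup_up)
    from mdeg_le_stair[OF this] have "mdeg (stair n) - mdeg (up i W) < mdeg (stair n) - mdeg W"
      by simp
    from less.hyps[OF this le] obtain k f where "sch n k (up i W) f" by blast
    from sch.step[OF this i(1)] i(2) show ?thesis by (auto simp: lookup_up)
  next
    case False
    \<comment> \<open>Strict decrease, read backwards from position n - 1, forces every entry up to
      the staircase.\<close>
    have ge: "n - 1 - j \<le> expo W j" for j
    proof (induction "n - 1 - j" arbitrary: j)
      case (Suc d)
      have "d = n - 1 - Suc j" using Suc.hyps(2) by linarith
      from Suc.hyps(1)[OF this] have "n - 1 - Suc j \<le> expo W (Suc j)" .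
      moreover have "Suc j < n" using Suc.hyps(2) by linarith
      with False have "expo W (Suc j) < expo W j" by (meson not_le)
      ultimately show ?case by linarith
    qed simp
    have "W = stair n"
      by (rule poly_mapping_eqI) (use ge less.prems in \<open>auto intro: antisym\<close>)
    then show ?thesis using sch.top by blast
  qed
qed

section \<open>Reduced words\<close>

text \<open>For \<open>v = u\<inverse>\<close> this is the code of \<open>w\<^sub>0 u\<inverse>\<close>, since composing with \<open>w\<^sub>0\<close> on the left
  reverses the order of the values.\<close>

definition code :: "nat \<Rightarrow> (nat \<Rightarrow> nat) \<Rightarrow> monom" where
  "code n v = (\<Sum>i<n. mvar_pow i (card {j. i < j \<and> j < n \<and> v i < v j}))"

lemma lookup_code: "expo (code n v) i = card {j. i < j \<and> j < n \<and> v i < v j}"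
proof (cases "i < n")
  case False
  then have "{j. i < j \<and> j < n \<and> v i < v j} = {}" by auto
  with False show ?thesis by (simp only: code_def lookup_sum_mvar_pow) simp
qed (simp add: code_def lookup_sum_mvar_pow)

lemma code_id: "code n id = stair n"
proof (rule poly_mapping_eqI)
  fix i
  have "{j. i < j \<and> j < n \<and> id i < id j} = {i<..<n}" by auto
  then show "expo (code n id) i = expo (stair n) i" by (simp only: lookup_code) simp
qed

lemma code_le: "expo (code n v) i \<le> n - 1 - i"
proof -
  have "card {j. i < j \<and> j < n \<and> v i < v j} \<le> card {i<..<n}"
    by (rule card_mono) auto
  then show ?thesis by (simp add: lookup_code)
qed

text \<open>Exchanging the values at \<open>i\<close> and \<open>i + 1\<close> exchanges their
  counts, except that the smaller value no longer has the larger one to its right.\<close>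

lemma code_adj:
  assumes i: "Suc i < n" "v i < v (Suc i)"
  shows "code n (v \<circ> adj i) = down i (code n v)" "expo (code n v) (Suc i) < expo (code n v) i"
proof -
  let ?S = "\<lambda>v i. {j. i < j \<and> j < n \<and> v i < v j}"
  have fin: "finite (?S w m)" for w :: "nat \<Rightarrow> nat" and m by auto
  have "?S v (Suc i) \<subset> ?S v i" using i by auto
  then show "expo (code n v) (Suc i) < expo (code n v) i"
    unfolding lookup_code by (rule psubset_card_mono[OF fin])
  show "code n (v \<circ> adj i) = down i (code n v)"
  proof (rule poly_mapping_eqI)
    fix m
    consider "m = i" | "m = Suc i" | "Suc i < m" | "m < i" by linarith
    then show "expo (code n (v \<circ> adj i)) m = expo (down i (code n v)) m"
    proof cases
      case 1
      have "?S (v \<circ> adj i) i = ?S v (Suc i)"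
        using i by (auto simp: adj_apply split: if_splits)
      with 1 show ?thesis by (simp only: lookup_code lookup_down if_True refl)
    next
      case 2
      have eq: "?S v i = insert (Suc i) (?S (v \<circ> adj i) (Suc i))"
        using i by (auto simp: adj_apply split: if_splits)
      have "card (?S v i) = Suc (card (?S (v \<circ> adj i) (Suc i)))"
        unfolding eq by (rule card_insert_disjoint[OF fin]) simp
      with 2 show ?thesis by (simp only: lookup_code lookup_down) simp
    next
      case 3
      then have "?S (v \<circ> adj i) m = ?S v m" by (auto simp: adj_apply)
      with 3 show ?thesis by (simp only: lookup_code lookup_down) simp
    next
      case 4
      \<comment> \<open>Both exchanged positions lie to the right of \<open>m\<close>, so the
        counted set is merely permuted.\<close>
      have "?S (v \<circ> adj i) m = adj i ` ?S v m"
      proof (intro equalityI subsetI)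
        fix j assume "j \<in> ?S (v \<circ> adj i) m"
        then have "adj i j \<in> ?S v m" using 4 i by (auto simp: adj_apply split: if_splits)
        then have "adj i (adj i j) \<in> adj i ` ?S v m" by (rule imageI)
        then show "j \<in> adj i ` ?S v m" by simp
      next
        fix j assume "j \<in> adj i ` ?S v m"
        then show "j \<in> ?S (v \<circ> adj i) m" using 4 i by (auto simp: adj_apply split: if_splits)
      qed
      then have "card (?S (v \<circ> adj i) m) = card (?S v m)"
        by (simp only: card_image[OF inj_on_subset[OF inj_adj subset_UNIV]])
      with 4 show ?thesis by (simp only: lookup_code lookup_down) simp
    qed
  qed
qed

text \<open>The ascent case applied to \<open>v\<close> after the exchange.\<close>

lemma code_adj_descent:
  assumes i: "Suc i < n" "v (Suc i) < v i"
  shows "code n (v \<circ> adj i) = up i (code n v)" "expo (code n v) i \<le> expo (code n v) (Suc i)"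
proof -
  let ?w = "v \<circ> adj i"
  have w: "?w i < ?w (Suc i)" "?w \<circ> adj i = v" using i by auto
  note c = code_adj[of i n ?w, OF i(1) w(1), unfolded w(2)]
  show "code n ?w = up i (code n v)" unfolding c(1) using c(2) by (simp add: up_down)
  show "expo (code n v) i \<le> expo (code n v) (Suc i)"
    unfolding c(1) using c(2) by (simp add: lookup_down)
qed

lemma adj_permutes: "Suc i < n \<Longrightarrow> adj i permutes {..<n}"
  unfolding adj_def by (rule permutes_swap_id) auto

lemma inv_adj_comp:
  assumes "u permutes S"
  shows "inv (adj i \<circ> u) = inv u \<circ> adj i"
proof (rule inv_unique_comp)
  show "(adj i \<circ> u) \<circ> (inv u \<circ> adj i) = id" "(inv u \<circ> adj i) \<circ> (adj i \<circ> u) = id"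
    using permutes_inverses[OF assms] by (auto simp: fun_eq_iff)
qed

lemma ascent_or_descent: "v permutes S \<Longrightarrow> v i < v (Suc i) \<or> v (Suc i) < v i"
  by (metis n_not_Suc_n nat_neq_iff permutes_inj injD)

lemma word_permutes: "is_word n u a \<Longrightarrow> u permutes {..<n}"
proof (induction a arbitrary: u)
  case Nil
  then have "u = id" by (simp add: is_word_def)
  then show ?case by (simp only: permutes_id)
next
  case (Cons i a)
  then obtain u' where "is_word n u' a" "u = adj i \<circ> u'" "Suc i < n" by (auto simp: is_word_def)
  then show ?case using Cons.IH permutes_compose[OF _ adj_permutes] by blast
qed

text \<open>A letter changes the degree of the code by one, so the length is minimal exactly if every
  letter is a descent of the code reached so far.\<close>

lemma word_code:
  "is_word n u a \<Longrightarrow> mdeg (stair n) \<le> mdeg (code n (inv u)) + length a \<and>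
    (mdeg (stair n) = mdeg (code n (inv u)) + length a \<longrightarrow>
      sch n (length a) (code n (inv u)) (foldr divdiff a (schubert_top n)))"
proof (induction a arbitrary: u)
  case Nil
  then have "u = id" by (simp add: is_word_def)
  then show ?case using sch.top[of n] by (simp add: code_id code_id[unfolded id_def])
next
  case (Cons i a)
  then obtain u' where u': "is_word n u' a" "u = adj i \<circ> u'" "Suc i < n" by (auto simp: is_word_def)
  define v where "v = inv u'"
  note IH = Cons.IH[OF u'(1), folded v_def]
  have perm: "u' permutes {..<n}" by (rule word_permutes[OF u'(1)])
  \<comment> \<open>A letter in front of the word acts on the positions of the inverse, where the
    code changes by a local move.\<close>
  have inv: "inv u = v \<circ> adj i" unfolding u'(2) v_def by (rule inv_adj_comp[OF perm])
  from ascent_or_descent[OF permutes_inv[OF perm], of i] consider "v i < v (Suc i)" | "v (Suc i) < v i"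
    by (auto simp: v_def)
  then show ?case
  proof cases
    case 1
    note c = code_adj[of i n v, OF u'(3) 1]
    have "mdeg (code n v) = Suc (mdeg (down i (code n v)))"
      by (rule mdeg_down) (use c(2) in simp)
    then show ?thesis
      unfolding inv c(1) using IH sch.step[OF _ u'(3) c(2)] by auto
  next
    case 2
    \<comment> \<open>Here degree and length both grow by one, so the inequality becomes strict and
      the claim about equality is vacuous.\<close>
    note c = code_adj_descent[of i n v, OF u'(3) 2]
    show ?thesis
      unfolding inv c(1) using IH by auto
  qed
qed

text \<open>Going down from the last position, whose value is below \<open>n\<close>, each value is
  at most its position.\<close>

lemma increasing_permutes_eq_id:
  assumes v: "v permutes {..<n}" and inc: "\<And>i. Suc i < n \<Longrightarrow> v i < v (Suc i)"
  shows "v = id"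
proof (rule permutes_natset_le[OF v], rule ballI)
  fix i assume "i \<in> {..<n}"
  then show "v i \<le> i"
  proof (induction "n - Suc i" arbitrary: i)
    case 0
    then have "v i < n" using permutes_in_image[OF v, of i] by simp
    with 0 show ?case by simp
  next
    case (Suc d)
    then have "v (Suc i) \<le> Suc i" by simp
    moreover have "v i < v (Suc i)" using Suc by (intro inc) simp
    ultimately show ?case by simp
  qed
qed

text \<open>Sorting by adjacent exchanges: undoing a descent of \<open>v\<close> raises the degree
  of the code by one, and without descents \<open>v\<close> is the identity. The bound of
  \<open>word_code\<close> is therefore attained.\<close>

lemma ex_word:
  assumes "v permutes {..<n}"
  shows "\<exists>a. is_word n (inv v) a \<and> mdeg (stair n) = mdeg (code n v) + length a"
  using assms
proof (induction "mdeg (stair n) - mdeg (code n v)" arbitrary: v rule: less_induct)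
  case less
  show ?case
  proof (cases "\<forall>i. Suc i < n \<longrightarrow> v i < v (Suc i)")
    case True
    with increasing_permutes_eq_id less.prems have "v = id" by blast
    then show ?thesis by (intro exI[of _ "[]"]) (simp add: is_word_def code_id code_id[unfolded id_def])
  next
    case False
    with ascent_or_descent[OF less.prems] obtain i where i: "Suc i < n" "v (Suc i) < v i" by blast
    define w where "w = v \<circ> adj i"
    have w: "w permutes {..<n}"
      unfolding w_def by (rule permutes_compose[OF adj_permutes[OF i(1)] less.prems])
    have c: "code n w = up i (code n v)" unfolding w_def by (rule code_adj_descent(1)[OF i])
    have "mdeg (code n w) \<le> mdeg (stair n)" by (rule mdeg_le_stair[OF code_le])
    then have "mdeg (stair n) - mdeg (code n w) < mdeg (stair n) - mdeg (code n v)" by (simp add: c)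
    from less.hyps[OF this w] obtain a
      where a: "is_word n (inv w) a" "mdeg (stair n) = mdeg (code n w) + length a" by blast
    have "inv v = adj i \<circ> inv w"
    proof (rule inv_unique_comp)
      have "v = w \<circ> adj i" by (simp add: w_def comp_assoc)
      then show "v \<circ> (adj i \<circ> inv w) = id" "adj i \<circ> inv w \<circ> v = id"
        using permutes_inverses[OF w] by (auto simp: fun_eq_iff)
    qed
    then have "is_word n (inv v) (i # a)" using a(1) i(1) by (simp add: is_word_def)
    then show ?thesis using a(2) c by (intro exI[of _ "i # a"]) simp
  qed
qed

text \<open>Whichever reduced word the choice operator picks, it has the length of the word from
  \<open>ex_word\<close>, and \<open>word_code\<close> covers all words of that length.\<close>

lemma sch_divdiff_perm:
  assumes u: "u permutes {..<n}"
  shows "\<exists>k. sch n k (code n (inv u)) (divdiff_perm n u (schubert_top n))"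
proof -
  obtain a where a: "is_word n u a" "mdeg (stair n) = mdeg (code n (inv u)) + length a"
    using ex_word[OF permutes_inv[OF u]] by (auto simp: permutes_inv_inv[OF u])
  have "length a \<le> length b" if "is_word n u b" for b
    using word_code[OF that] a(2) by simp
  with a(1) have red: "is_reduced_word n u a" by (auto simp: is_reduced_word_def)
  define b where "b = (SOME b. is_reduced_word n u b)"
  have b: "is_reduced_word n u b" unfolding b_def using red by (rule someI)
  then have "length b = length a" using red by (auto simp: is_reduced_word_def intro: antisym)
  then show ?thesis
    using word_code[of n u b] a(2) b unfolding divdiff_perm_def b_def[symmetric]
    by (auto simp: is_reduced_word_def)
qed

text \<open>A descent of the code of \<open>inv u\<close> excludes a descent of \<open>inv u\<close>
  itself at that position, so each derivation step is matched by a letter put in front of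
  \<open>u\<close>.\<close>

lemma sch_code: "sch n k W f \<Longrightarrow> \<exists>u. u permutes {..<n} \<and> code n (inv u) = W"
proof (induction rule: sch.induct)
  case top
  show ?case by (rule exI[of _ id]) (simp only: permutes_id inv_id code_id simp_thms)
next
  case (step k W f i)
  then obtain u where u: "u permutes {..<n}" "code n (inv u) = W" by blast
  have "\<not> inv u (Suc i) < inv u i"
    using code_adj_descent(2)[OF step.hyps(2), of "inv u"] step.hyps(3) u(2) by force
  then have "inv u i < inv u (Suc i)"
    using ascent_or_descent[OF permutes_inv[OF u(1)], of i] by blast
  then have "code n (inv (adj i \<circ> u)) = down i W"
    using code_adj(1)[OF step.hyps(2), of "inv u"] u by (simp add: inv_adj_comp[OF u(1)])
  then show ?case using permutes_compose[OF u(1) adj_permutes[OF step.hyps(2)]] by blast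
qed

lemma is_schubert_iff: "is_schubert f \<longleftrightarrow> (\<exists>n k W. sch n k W f)"
proof
  assume "is_schubert f"
  then show "\<exists>n k W. sch n k W f"
    unfolding is_schubert_def using sch_divdiff_perm by blast
next
  assume "\<exists>n k W. sch n k W f"
  then obtain n k W where "sch n k W f" by blast
  \<comment> \<open>Schubert polynomials are declared for \<open>n\<close> at least 2 only, whereas
    derivations may have smaller \<open>n\<close>.\<close>
  then obtain k where k: "sch (max n 2) k W f" using sch_mono[OF max.cobounded1] by blast
  with sch_code obtain u where u: "u permutes {..<max n 2}" "code (max n 2) (inv u) = W" by blast
  with sch_divdiff_perm[OF u(1)] sch_unique[OF k]
  have "f = divdiff_perm (max n 2) u (schubert_top (max n 2))" by blast
  with u(1) show "is_schubert f"
    unfolding is_schubert_def by (intro exI[of _ "max n 2"] conjI exI[of _ u]) simp_all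
qed

lemma schubert_sch: "\<exists>n k. sch n k W (schubert W)"
proof -
  \<comment> \<open>Large enough that \<open>j + expo W j\<close> is at most n - 1 on the support,
    so \<open>W\<close> fits under the staircase.\<close>
  define n where "n = Suc (\<Sum>j\<in>Poly_Mapping.keys W. j + expo W j)"
  have "expo W j \<le> n - 1 - j" for j
  proof (cases "j \<in> Poly_Mapping.keys W")
    case True
    then have "j + expo W j \<le> (\<Sum>j\<in>Poly_Mapping.keys W. j + expo W j)"
      by (intro member_le_sum) auto
    then show ?thesis by (simp add: n_def)
  qed (simp add: in_keys_iff)
  from sch_exists[OF this] obtain k f where f: "sch n k W f" by blast
  have "schubert W = f"
    unfolding schubert_def
  proof (rule the_equality)
    show "is_schubert f \<and> lead_monom f = W"
      using f is_schubert_iff sch_monic_lead lead_monom_eqI by blast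
    fix g assume g: "is_schubert g \<and> lead_monom g = W"
    then obtain m l V where m: "sch m l V g" unfolding is_schubert_iff by blast
    with g lead_monom_eqI[OF sch_monic_lead] have "V = W" by blast
    with m f sch_unique show "g = f" by blast
  qed
  with f show ?thesis by blast
qed

section \<open>The Schubert basis\<close>

lemma schubert_monic_lead: "monic_lead (schubert W) W"
  using schubert_sch sch_monic_lead by blast

lemma schubert_homog: "homog (mdeg W) (schubert W)"
  using schubert_sch sch_homog by blast

abbreviation schubert_comb :: "(monom \<Rightarrow>\<^sub>0 int) \<Rightarrow> mpoly" where
  "schubert_comb \<equiv> frag_extend schubert"

text \<open>Unitriangularity: at the largest index \<open>W\<close> of \<open>c\<close> only
  \<open>b W\<close> has a term in \<open>W\<close>. It yields linear independence and the leading
  monomials of combinations.\<close>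

lemma monic_lead_frag_extend:
  assumes lead: "\<And>U. monic_lead (b U) U" and "c \<noteq> 0"
  obtains W where "W \<in> Poly_Mapping.keys c"
    "\<And>U. U \<in> Poly_Mapping.keys c \<Longrightarrow> U \<noteq> W \<Longrightarrow> mless U W"
    "Poly_Mapping.lookup (frag_extend b c) W = Poly_Mapping.lookup c W"
    "\<And>V. V \<in> Poly_Mapping.keys (frag_extend b c) \<Longrightarrow> V = W \<or> mless V W"
proof -
  have "\<exists>W\<in>K. \<forall>U\<in>K. U \<noteq> W \<longrightarrow> mless U W" if "finite K" "K \<noteq> {}" for K
    using that
  proof (induction K rule: finite_ne_induct)
    case (insert x K)
    then obtain W where W: "W \<in> K" "\<forall>U\<in>K. U \<noteq> W \<longrightarrow> mless U W" by blast
    consider "x = W" | "mless x W" | "mless W x" using mless_linear by blast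
    then show ?case
    proof cases
      case 3
      with W mless_trans show ?thesis by (intro bexI[of _ x]) auto
    qed (use W in auto)
  qed simp
  from this[OF finite_keys, of c] \<open>c \<noteq> 0\<close> obtain W
    where W: "W \<in> Poly_Mapping.keys c" "\<And>U. U \<in> Poly_Mapping.keys c \<Longrightarrow> U \<noteq> W \<Longrightarrow> mless U W"
    by auto
  have "Poly_Mapping.lookup (frag_extend b c) W
      = (\<Sum>U\<in>Poly_Mapping.keys c. Poly_Mapping.lookup c U * Poly_Mapping.lookup (b U) W)"
    by (simp add: frag_extend_def lookup_sum)
  also have "\<dots> = (\<Sum>U\<in>{W}. Poly_Mapping.lookup c U * Poly_Mapping.lookup (b U) W)"
  proof (rule sum.mono_neutral_right)
    show "\<forall>U\<in>Poly_Mapping.keys c - {W}. Poly_Mapping.lookup c U * Poly_Mapping.lookup (b U) W = 0"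
    proof
      fix U assume "U \<in> Poly_Mapping.keys c - {W}"
      then have "mless U W" "W \<noteq> U" using W(2) by auto
      then have "W \<notin> Poly_Mapping.keys (b U)"
        using lead[of U] mless_asym unfolding monic_lead_def by blast
      then show "Poly_Mapping.lookup c U * Poly_Mapping.lookup (b U) W = 0" by (simp add: in_keys_iff)
    qed
  qed (use W in auto)
  also have "\<dots> = Poly_Mapping.lookup c W" using lead[of W] by (simp add: monic_lead_def)
  finally have 3: "Poly_Mapping.lookup (frag_extend b c) W = Poly_Mapping.lookup c W" .
  have 4: "V = W \<or> mless V W" if V: "V \<in> Poly_Mapping.keys (frag_extend b c)" for V
  proof -
    obtain U where U: "U \<in> Poly_Mapping.keys c" "V \<in> Poly_Mapping.keys (b U)"
      using subsetD[OF keys_frag_extend V] by auto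
    have "V = U \<or> mless V U" using lead[of U] U(2) unfolding monic_lead_def by blast
    moreover have "U = W \<or> mless U W" using W(2) U(1) by blast
    ultimately show ?thesis using mless_trans by blast
  qed
  show ?thesis by (rule that[OF W 3 4])
qed

lemma schubert_comb_inject: "schubert_comb c = schubert_comb d \<Longrightarrow> c = d"
proof (rule ccontr)
  assume eq: "schubert_comb c = schubert_comb d" and "c \<noteq> d"
  then have "c - d \<noteq> 0" by simp
  then obtain W where W: "W \<in> Poly_Mapping.keys (c - d)"
    "Poly_Mapping.lookup (schubert_comb (c - d)) W = Poly_Mapping.lookup (c - d) W"
    using monic_lead_frag_extend[of schubert "c - d", OF schubert_monic_lead] by metis
  have "schubert_comb (c - d) = 0" by (simp add: frag_extend_diff eq)
  with W show False by (simp add: in_keys_iff)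
qed

text \<open>A monomial is its Schubert polynomial minus smaller terms, which by homogeneity have the
  same degree, so the induction over one degree applies.\<close>

lemma schubert_comb_surj: "\<exists>c. schubert_comb c = f"
proof -
  have comb: "\<exists>c. schubert_comb c = g"
    if "\<And>U. U \<in> Poly_Mapping.keys g \<Longrightarrow> \<exists>c. schubert_comb c = monom_poly U" for g
  proof (rule frag_induction[of g "Poly_Mapping.keys g"])
    show "\<exists>c. schubert_comb c = 0" by (rule exI[of _ 0]) simp
    show "\<exists>c. schubert_comb c = frag_of U" if "U \<in> Poly_Mapping.keys g" for U
      using \<open>\<And>U. U \<in> Poly_Mapping.keys g \<Longrightarrow> _\<close>[OF that] by (simp only: monom_poly_def)
    show "\<exists>c. schubert_comb c = a - b"
      if "\<exists>c. schubert_comb c = a" "\<exists>c. schubert_comb c = b" for a b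
      using that by (metis frag_extend_diff)
  qed simp
  have "\<exists>c. schubert_comb c = monom_poly U" for U
  proof (induction U rule: finite_mless_same_mdeg_induct)
    case (less U)
    define r where "r = schubert U - monom_poly U"
    have "mless V U \<and> mdeg V = mdeg U" if "V \<in> Poly_Mapping.keys r" for V
    proof -
      have "V \<noteq> U"
        using that schubert_monic_lead[of U]
        by (auto simp: r_def in_keys_iff lookup_minus monom_poly_def monic_lead_def)
      moreover from this have "V \<in> Poly_Mapping.keys (schubert U)"
        using that by (simp add: r_def in_keys_iff lookup_minus monom_poly_def lookup_single)
      ultimately show ?thesis
        using schubert_monic_lead[of U] schubert_homog[of U] by (auto simp: monic_lead_def homog_def)
    qed
    with less comb obtain c where "schubert_comb c = r" by blast
    then have "schubert_comb (frag_of U - c) = monom_poly U"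
      by (simp add: frag_extend_diff r_def)
    then show ?case by blast
  qed
  then show ?thesis by (rule comb)
qed

lemma of_int_mult_eq_frag_cmul: "of_int k * f = frag_cmul k (f :: mpoly)"
proof -
  have "of_int k * f = Poly_Mapping.map ((*) k) f"
    by (simp add: mult_map_scale_conv_mult flip: single_of_int)
  also have "\<dots> = frag_cmul k f"
    by (rule poly_mapping_eqI) (simp add: map.rep_eq when_def)
  finally show ?thesis .
qed

text \<open>Turns the formal sum over all monomials into a linear extension, whose sum runs over the
  finite support of \<open>c\<close>.\<close>

lemma Sum_any_eq_frag_extend:
  "(\<Sum>W. of_int (Poly_Mapping.lookup c W) * b W) = frag_extend b (c :: monom \<Rightarrow>\<^sub>0 int)"
  for b :: "monom \<Rightarrow> mpoly"
  unfolding frag_extend_def of_int_mult_eq_frag_cmul[symmetric]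
  by (rule Sum_any.expand_superset) (auto simp: in_keys_iff)

section \<open>Structure constants and their triangularity\<close>

definition schubert_prod :: "monom \<Rightarrow> monom \<Rightarrow> (monom \<Rightarrow>\<^sub>0 int)" where
  "schubert_prod U V = (THE c. schubert_comb c = schubert U * schubert V)"

lemma sconst_eq: "sconst U V W = Poly_Mapping.lookup (schubert_prod U V) W"
  unfolding sconst_def schubert_prod_def Sum_any_eq_frag_extend
  by (simp only: eq_commute[of "schubert U * schubert V"])

lemma schubert_comb_prod: "schubert_comb (schubert_prod U V) = schubert U * schubert V"
proof -
  obtain c where "schubert_comb c = schubert U * schubert V" using schubert_comb_surj by blast
  moreover from this have "schubert_prod U V = c"
    unfolding schubert_prod_def using schubert_comb_inject by (intro the_equality) auto
  ultimately show ?thesis by simp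
qed

text \<open>After splitting off the leading terms, every remaining product has a strictly smaller
  factor, and the order is compatible with multiplication.\<close>

lemma monic_lead_mult:
  assumes f: "monic_lead f U" and g: "monic_lead g V"
  shows "monic_lead (f * g) (U + V)"
proof -
  define f' g' where "f' = f - monom_poly U" and "g' = g - monom_poly V"
  have rest: "\<exists>A B. W = A + B \<and> (A = U \<or> mless A U) \<and> (B = V \<or> mless B V) \<and> (A \<noteq> U \<or> B \<noteq> V)"
    if W: "W \<in> Poly_Mapping.keys (monom_poly U * g' + f' * g)" for W
  proof -
    have f': "mless A U" if "A \<in> Poly_Mapping.keys f'" for A
      using that f by (cases "A = U")
        (auto simp: f'_def monic_lead_def in_keys_iff lookup_minus monom_poly_def lookup_single)
    have g': "mless B V" if "B \<in> Poly_Mapping.keys g'" for B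
      using that g by (cases "B = V")
        (auto simp: g'_def monic_lead_def in_keys_iff lookup_minus monom_poly_def lookup_single)
    from subsetD[OF keys_add W] consider "W \<in> Poly_Mapping.keys (monom_poly U * g')" | "W \<in> Poly_Mapping.keys (f' * g)"
      by auto
    then show ?thesis
    proof cases
      case 1
      then obtain B where B: "W = U + B" "B \<in> Poly_Mapping.keys g'"
        using subsetD[OF keys_mult, of W "monom_poly U" g'] by (auto simp: monom_poly_def)
      have "mless B V" by (rule g'[OF B(2)])
      then have "B \<noteq> V" using mless_irrefl by auto
      with B(1) \<open>mless B V\<close> show ?thesis by blast
    next
      case 2
      then obtain A B where AB: "W = A + B" "A \<in> Poly_Mapping.keys f'" "B \<in> Poly_Mapping.keys g"
        using subsetD[OF keys_mult, of W f' g] by auto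
      have "mless A U" by (rule f'[OF AB(2)])
      then have "A \<noteq> U" using mless_irrefl by auto
      moreover have "B = V \<or> mless B V" using g AB(3) by (auto simp: monic_lead_def)
      ultimately show ?thesis using AB(1) \<open>mless A U\<close> by blast
    qed
  qed
  have less: "mless W (U + V)" if W: "W \<in> Poly_Mapping.keys (monom_poly U * g' + f' * g)" for W
  proof -
    obtain A B where AB: "W = A + B" "A = U \<or> mless A U" "B = V \<or> mless B V" "A \<noteq> U \<or> B \<noteq> V"
      using rest[OF W] by auto
    then show ?thesis
      using mless_add_left[of B V A] mless_add_right[of A U V] mless_trans[of "A + B" "A + V" "U + V"]
      by auto
  qed
  have eq: "f * g = monom_poly (U + V) + (monom_poly U * g' + f' * g)"
    by (simp add: f'_def g'_def algebra_simps monom_poly_mult)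
  have "Poly_Mapping.lookup (monom_poly U * g' + f' * g) (U + V) = 0"
    using less[of "U + V"] mless_irrefl by (auto simp: in_keys_iff)
  then have "Poly_Mapping.lookup (f * g) (U + V) = 1"
    unfolding eq by (subst lookup_add) (simp add: monom_poly_def)
  moreover have "mless W (U + V)" if "W \<in> Poly_Mapping.keys (f * g)" "W \<noteq> U + V" for W
  proof (rule less)
    show "W \<in> Poly_Mapping.keys (monom_poly U * g' + f' * g)"
      using that unfolding eq in_keys_iff
      by (subst (asm) lookup_add) (simp add: monom_poly_def lookup_single)
  qed
  ultimately show ?thesis by (simp add: monic_lead_def)
qed

text \<open>A family of coefficients has the type of a polynomial, so \<open>monic_lead\<close>
  expresses triangularity of the structure constants. The largest index with nonzero constant must
  be the leading monomial of the product, with the same coefficient.\<close>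

lemma schubert_prod_monic_lead: "monic_lead (schubert_prod U V) (U + V)"
proof -
  let ?c = "schubert_prod U V" and ?p = "schubert U * schubert V"
  have p: "monic_lead ?p (U + V)"
    by (intro monic_lead_mult schubert_monic_lead)
  then have "U + V \<in> Poly_Mapping.keys ?p" by (simp add: monic_lead_def in_keys_iff)
  then have "?c \<noteq> 0" using schubert_comb_prod[of U V] by auto
  then obtain W where W: "W \<in> Poly_Mapping.keys ?c"
    "\<And>U'. U' \<in> Poly_Mapping.keys ?c \<Longrightarrow> U' \<noteq> W \<Longrightarrow> mless U' W"
    "Poly_Mapping.lookup ?p W = Poly_Mapping.lookup ?c W"
    "\<And>V'. V' \<in> Poly_Mapping.keys ?p \<Longrightarrow> V' = W \<or> mless V' W"
    using monic_lead_frag_extend[of schubert ?c, OF schubert_monic_lead]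
    unfolding schubert_comb_prod by metis
  have "W \<in> Poly_Mapping.keys ?p" using W(1,3) by (simp add: in_keys_iff)
  then have "W = U + V \<or> mless W (U + V)" using p by (auto simp: monic_lead_def)
  moreover have "U + V = W \<or> mless (U + V) W"
    using W(4) \<open>U + V \<in> Poly_Mapping.keys ?p\<close> by blast
  ultimately have "W = U + V" using mless_asym by blast
  with W p show ?thesis by (auto simp: monic_lead_def)
qed

text \<open>There is no smaller monomial of the same degree.\<close>

lemma homog_monic_lead_minimal:
  assumes f: "homog t f" "monic_lead f (mvar_pow 0 t)"
  shows "f = monom_poly (mvar_pow 0 t)"
proof (rule poly_mapping_eqI)
  fix V
  show "Poly_Mapping.lookup f V = Poly_Mapping.lookup (monom_poly (mvar_pow 0 t)) V"
  proof (cases "V = mvar_pow 0 t")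
    case True
    with f(2) show ?thesis by (simp add: monic_lead_def monom_poly_def)
  next
    case False
    have "V \<notin> Poly_Mapping.keys f"
    proof
      assume V: "V \<in> Poly_Mapping.keys f"
      with f(1) have d: "mdeg V = t" by (auto simp: homog_def)
      from V False f(2) have "mless V (mvar_pow 0 t)" by (auto simp: monic_lead_def)
      with d obtain i where i: "expo V i < expo (mvar_pow 0 t) i"
        "\<And>j. i < j \<Longrightarrow> expo V j = expo (mvar_pow 0 t) j"
        by (auto simp: mless_def)
      then have "i = 0" by (auto simp: lookup_mvar_pow split: if_splits)
      have "Poly_Mapping.keys V \<subseteq> {0}"
      proof
        fix j assume "j \<in> Poly_Mapping.keys V"
        then have "\<not> 0 < j" using i(2)[of j] \<open>i = 0\<close> by (auto simp: in_keys_iff lookup_mvar_pow)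
        then show "j \<in> {0}" by simp
      qed
      then have "mdeg V = (\<Sum>j\<in>{0}. expo V j)" by (intro mdeg_superset) simp_all
      with d i(1) \<open>i = 0\<close> show False by (simp add: lookup_mvar_pow)
    qed
    with False show ?thesis by (simp add: in_keys_iff monom_poly_def lookup_single)
  qed
qed

text \<open>Both sides are homogeneous with leading monomial the smallest one of their degree, so
  both are that monomial.\<close>

lemma schubert_mvar_0_mult:
  assumes "t \<ge> 1"
  shows "schubert (mvar 0) * schubert (mvar_pow 0 (t - 1)) = schubert (mvar_pow 0 t)"
proof -
  have t: "mvar 0 + mvar_pow 0 (t - 1) = mvar_pow 0 t"
    by (rule poly_mapping_eqI) (use assms in \<open>auto simp: lookup_add lookup_mvar_pow\<close>)
  have "homog (1 + (t - 1)) (schubert (mvar 0) * schubert (mvar_pow 0 (t - 1)))"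
    by (rule homog_mult) (metis schubert_homog mdeg_mvar_pow)+
  then have "homog t (schubert (mvar 0) * schubert (mvar_pow 0 (t - 1)))"
    using assms by simp
  moreover have "monic_lead (schubert (mvar 0) * schubert (mvar_pow 0 (t - 1))) (mvar_pow 0 t)"
    using monic_lead_mult[OF schubert_monic_lead schubert_monic_lead, of "mvar 0" "mvar_pow 0 (t - 1)"]
    unfolding t .
  moreover have "homog t (schubert (mvar_pow 0 t))"
    using schubert_homog[of "mvar_pow 0 t"] by simp
  ultimately show ?thesis using homog_monic_lead_minimal schubert_monic_lead by metis
qed

section \<open>Double sums of structure constants\<close>

lemma frag_extend_mult_left:
  "frag_extend (\<lambda>W. f * b W) c = (f :: mpoly) * frag_extend b c"
  unfolding frag_extend_def of_int_mult_eq_frag_cmul[symmetric] sum_distrib_left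
  by (rule sum.cong) (simp_all add: mult.left_commute)

text \<open>Nonzero terms lie over the finitely many \<open>W\<close> in the support of
  \<open>c\<close> and, for each, the support of \<open>d W\<close>. Finiteness gives the formal sum
  its meaning, since with infinite support it would be 0 by convention.\<close>

lemma Sum_any_pair_schubert:
  fixes c :: "monom \<Rightarrow>\<^sub>0 int" and d :: "monom \<Rightarrow> monom \<Rightarrow>\<^sub>0 int"
  shows "finite {(W, Z). Poly_Mapping.lookup c W * Poly_Mapping.lookup (d W) Z \<noteq> 0}" (is "finite ?A")
    and "(\<Sum>(W, Z). of_int (Poly_Mapping.lookup c W * Poly_Mapping.lookup (d W) Z) * schubert Z)
      = frag_extend (\<lambda>W. schubert_comb (d W)) c"
proof -
  let ?S = "SIGMA W:Poly_Mapping.keys c. Poly_Mapping.keys (d W)"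
  let ?f = "\<lambda>W Z. of_int (Poly_Mapping.lookup c W * Poly_Mapping.lookup (d W) Z) * schubert Z"
  have fin: "finite ?S" by (rule finite_SigmaI) simp_all
  have "?A \<subseteq> ?S" by (auto simp: in_keys_iff)
  then show "finite ?A" using fin by (rule finite_subset)
  have "(\<Sum>(W, Z). ?f W Z) = (\<Sum>(W, Z)\<in>?S. ?f W Z)"
    by (rule Sum_any.expand_superset[OF fin]) (auto simp: in_keys_iff)
  also have "\<dots> = (\<Sum>W\<in>Poly_Mapping.keys c. \<Sum>Z\<in>Poly_Mapping.keys (d W). ?f W Z)"
    by (rule sum.Sigma[symmetric]) simp_all
  also have "\<dots> = frag_extend (\<lambda>W. schubert_comb (d W)) c"
    unfolding frag_extend_def of_int_mult_eq_frag_cmul[symmetric] sum_distrib_left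
    by (simp add: mult.assoc)
  finally show "(\<Sum>(W, Z). ?f W Z) = frag_extend (\<lambda>W. schubert_comb (d W)) c" .
qed

lemma schubert_mult_mult:
  "finite {(W, Z). sconst A W Z * sconst B V W \<noteq> 0}"
  "(\<Sum>(W, Z). of_int (sconst A W Z * sconst B V W) * schubert Z)
    = schubert A * (schubert B * schubert V)"
proof -
  note * = mult.commute[of "sconst A W Z" "sconst B V W" for W Z]
  note S = Sum_any_pair_schubert[of "schubert_prod B V" "schubert_prod A", folded sconst_eq]
  show "finite {(W, Z). sconst A W Z * sconst B V W \<noteq> 0}" unfolding * by (rule S(1))
  show "(\<Sum>(W, Z). of_int (sconst A W Z * sconst B V W) * schubert Z)
    = schubert A * (schubert B * schubert V)"
    unfolding * S(2) by (simp only: schubert_comb_prod frag_extend_mult_left)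
qed

text \<open>The constant at \<open>U\<close> is 1 and all other nonzero ones lie below
  \<open>U\<close>, so removing \<open>frag_of U\<close> from the family is the same as restricting
  to \<open>W\<close> below \<open>U\<close>.\<close>

lemma schubert_mult_lower:
  assumes "A + B = U"
  shows "finite {(W, Z). mless W U \<and> sconst A B W * sconst W V Z \<noteq> 0}"
    "(\<Sum>(W, Z). of_int (sconst A B W * sconst W V Z) * schubert Z when mless W U)
      = (schubert A * schubert B - schubert U) * schubert V"
proof -
  define c where "c = schubert_prod A B - frag_of U"
  have c: "Poly_Mapping.lookup c W = (sconst A B W when mless W U)" for W
    using schubert_prod_monic_lead[of A B] mless_irrefl[of U]
    by (cases "W = U") (auto simp: c_def assms monic_lead_def lookup_minus lookup_single sconst_eq
      in_keys_iff when_def)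
  note S = Sum_any_pair_schubert[of c "\<lambda>W. schubert_prod W V", folded sconst_eq]
  have "{(W, Z). mless W U \<and> sconst A B W * sconst W V Z \<noteq> 0}
      = {(W, Z). Poly_Mapping.lookup c W * sconst W V Z \<noteq> 0}"
    by (auto simp: c when_def split: if_splits)
  then show "finite {(W, Z). mless W U \<and> sconst A B W * sconst W V Z \<noteq> 0}" using S(1) by simp
  have "(\<Sum>(W, Z). of_int (sconst A B W * sconst W V Z) * schubert Z when mless W U)
      = (\<Sum>(W, Z). of_int (Poly_Mapping.lookup c W * sconst W V Z) * schubert Z)"
    by (rule Sum_any.cong) (auto simp: c when_def)
  also have "\<dots> = frag_extend (\<lambda>W. schubert V * schubert W) c"
    unfolding S(2) by (simp only: schubert_comb_prod mult.commute)
  also have "\<dots> = schubert V * (schubert A * schubert B - schubert U)"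
    by (simp only: frag_extend_mult_left c_def frag_extend_diff schubert_comb_prod frag_extend_of)
  finally show "(\<Sum>(W, Z). of_int (sconst A B W * sconst W V Z) * schubert Z when mless W U)
      = (schubert A * schubert B - schubert U) * schubert V"
    by (simp only: mult.commute)
qed

theorem mainTheorem5:
  fixes U V :: monom and t :: nat
  assumes "min (mdeg U) (mdeg V) = mdeg U" and "mdeg U = t" and "t \<ge> 2"
  shows
    "(U = mvar_pow 0 t \<longrightarrow>
        finite {(W, Z). sconst (mvar 0) Z W * sconst (mvar_pow 0 (t - 1)) V Z \<noteq> 0} \<and>
        schubert U * schubert V =
          (\<Sum>(W, Z). of_int (sconst (mvar 0) Z W * sconst (mvar_pow 0 (t - 1)) V Z) * schubert W))
     \<and>
     (\<forall>k. mless (mvar_pow 0 t) U \<and> expo U k \<ge> 1 \<longrightarrow>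
        finite {(W, Z). sconst (mvar k) W Z * sconst (U - mvar k) V W \<noteq> 0} \<and>
        finite {(W, Z). mless W U \<and> sconst (mvar k) (U - mvar k) W * sconst W V Z \<noteq> 0} \<and>
        schubert U * schubert V =
          (\<Sum>(W, Z). of_int (sconst (mvar k) W Z * sconst (U - mvar k) V W) * schubert Z)
          - (\<Sum>(W, Z). of_int (sconst (mvar k) (U - mvar k) W * sconst W V Z) * schubert Z
               when mless W U))"
proof (intro conjI impI allI)
  let ?g = "\<lambda>W Z. of_int (sconst (mvar 0) W Z * sconst (mvar_pow 0 (t - 1)) V W) * schubert Z"
  note prod = schubert_mult_mult[of "mvar 0" "mvar_pow 0 (t - 1)" V]
  \<comment> \<open>In (a) the summation letters have the opposite roles to those in
    \<open>schubert_mult_mult\<close>, hence the exchange of the pairs.\<close>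
  have "{(W, Z). sconst (mvar 0) Z W * sconst (mvar_pow 0 (t - 1)) V Z \<noteq> 0}
      = prod.swap ` {(W, Z). sconst (mvar 0) W Z * sconst (mvar_pow 0 (t - 1)) V W \<noteq> 0}"
    by auto
  then show "finite {(W, Z). sconst (mvar 0) Z W * sconst (mvar_pow 0 (t - 1)) V Z \<noteq> 0}"
    using prod(1) by simp
  have "(\<Sum>(W, Z). ?g W Z) = (\<Sum>(W, Z). ?g Z W)"
    by (rule Sum_any.reindex_cong[of prod.swap]) (auto simp: fun_eq_iff)
  moreover assume "U = mvar_pow 0 t"
  then have "schubert U * schubert V = schubert (mvar 0) * (schubert (mvar_pow 0 (t - 1)) * schubert V)"
    using schubert_mvar_0_mult[of t] assms(3) by (simp add: mult.assoc[symmetric])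
  ultimately show "schubert U * schubert V = (\<Sum>(W, Z). ?g Z W)" using prod(2) by simp
next
  fix k assume "mless (mvar_pow 0 t) U \<and> expo U k \<ge> 1"
  \<comment> \<open>Positivity of the exponent at \<open>k\<close> makes the truncated subtraction
    an exact division.\<close>
  then have U: "mvar k + (U - mvar k) = U"
    by (intro poly_mapping_eqI) (auto simp: lookup_add lookup_minus lookup_mvar_pow)
  show "finite {(W, Z). sconst (mvar k) W Z * sconst (U - mvar k) V W \<noteq> 0}"
    by (rule schubert_mult_mult)
  show "finite {(W, Z). mless W U \<and> sconst (mvar k) (U - mvar k) W * sconst W V Z \<noteq> 0}"
    by (rule schubert_mult_lower[OF U])
  show "schubert U * schubert V =
      (\<Sum>(W, Z). of_int (sconst (mvar k) W Z * sconst (U - mvar k) V W) * schubert Z)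
      - (\<Sum>(W, Z). of_int (sconst (mvar k) (U - mvar k) W * sconst W V Z) * schubert Z
           when mless W U)"
    unfolding schubert_mult_mult(2) schubert_mult_lower(2)[OF U] by (simp add: algebra_simps)
qed

end
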